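(* Let $p\ge 1$, let $\mu,\beta\in\mathbf{R}^p$, let $A$ be a full-rank $p\times p$ real matrix, let $X$ be a scalar random variable with density $g(x)$ on $x\in(0,\infty)$, and let $Z$ be a $p\times 1$ standard normal vector independent of $X$. Let $f(y)$, $y\in\mathbf{R}^p$, denote the density of $Y=\mu+\beta X+\sqrt{X}\,AZ$, and let $g^*(x)=x^{-(p-1)/2}g(x)$ for $x\in(0,\infty)$. Then: (i) If $g^*$ is unimodal, then $f$ has only one local maximum, which lies on the line $y=\mu+\beta t$, $t\in\mathbf{R}$. (ii) If $g^*$ decreases on $(0,\infty)$, or $\beta=0$, then the only local maximum of $f$ is at $y=\mu$. (iii) If $g^*$ is log-concave, then so is $f$. (iv) If $g^*$ is log-convex on $(0,\infty)$, then for every nonzero $b\in\mathbf{R}^p$ the function $t\mapsto f(\mu+bt)$ is log-convex on $t\in(0,\infty)$.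
   Context: The density of $Y$ is taken to be the mixture density $f(y)=\int_0^\infty (2\pi x)^{-p/2}|\det A|^{-1}\exp\left(-\frac{\|A^{-1}(y-\mu-\beta x)\|^2}{2x}\right)g(x)\,dx$, $y\in\mathbf{R}^p$, where $\|\cdot\|$ is the Euclidean norm; the value $f(\mu)=+\infty$ is allowed, in which case $\mu$ counts as a local maximum. "Increases" and "decreases" are meant in the non-strict sense. The function $g^*$ on $(0,\infty)$ is unimodal if there is $x_*\in[0,\infty)$ such that $g^*$ increases on $(0,x_*]$ and decreases on $[x_*,\infty)\cap(0,\infty)$ (in particular a $g^*$ that decreases on $(0,\infty)$ is unimodal). A nonnegative function $h$ on a convex set $D$ (here $D=(0,\infty)$ or $D=\mathbf{R}^p$) is log-concave if $h(\theta x+(1-\theta)y)\ge[h(x)]^\theta[h(y)]^{1-\theta}$ for all $x,y\in D$, $\theta\in(0,1)$. A positive function $h$ on an interval $I$ is log-convex on $I$ if $\log h$ is convex on $I$. *)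

theory Defs
  imports "HOL-Probability.Probability"
begin

definition std_normal_vec_density :: "real ^ 'p \<Rightarrow> real" where
  "std_normal_vec_density z = (2 * pi) powr (- real CARD('p) / 2) * exp (- (norm z)\<^sup>2 / 2)"

text \<open>The conditional law of \<open>\<mu> + X \<beta> + sqrt X (A Z)\<close> given \<open>X = x\<close> is normal with mean
  \<open>\<mu> + x \<beta>\<close> and covariance matrix \<open>x A A\<^sup>T\<close>. The integral is \<open>ennreal\<close>-valued, so it may
  be infinite; \<open>g\<close> is meant to be nonnegative on \<open>{0<..}\<close>, its values elsewhere are irrelevant.\<close>

definition mixture_density ::
    "real ^ 'p \<Rightarrow> real ^ 'p \<Rightarrow> real ^ 'p ^ 'p \<Rightarrow> (real \<Rightarrow> real) \<Rightarrow> real ^ 'p \<Rightarrow> ennreal" where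
  "mixture_density \<mu> \<beta> A g y =
     (\<integral>\<^sup>+ x \<in> {0<..}. ennreal
        ((2 * pi * x) powr (- real CARD('p) / 2) * inverse \<bar>det A\<bar>
         * exp (- (norm (matrix_inv A *v (y - \<mu> - x *\<^sub>R \<beta>)))\<^sup>2 / (2 * x)) * g x) \<partial>lborel)"

definition gstar :: "nat \<Rightarrow> (real \<Rightarrow> real) \<Rightarrow> real \<Rightarrow> real" where
  "gstar p g x = x powr (- (real p - 1) / 2) * g x"

text \<open>Local maxima are non-strict. For an \<open>ennreal\<close>-valued function every point with value
  \<open>\<infinity>\<close> is a local maximum.\<close>

definition local_max :: "('a::topological_space \<Rightarrow> 'b::order) \<Rightarrow> 'a \<Rightarrow> bool" where
  "local_max f y \<longleftrightarrow> (\<forall>\<^sub>F z in nhds y. f z \<le> f y)"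

definition unimodal_pos :: "(real \<Rightarrow> real) \<Rightarrow> bool" where
  "unimodal_pos h \<longleftrightarrow>
     (\<exists>m\<ge>0. mono_on {0<..m} h \<and> antimono_on ({m..} \<inter> {0<..}) h)"

text \<open>Zeros of \<open>h\<close> are allowed: \<open>0 powr \<theta> = 0\<close>, so the inequality is trivial if \<open>h x = 0\<close> or
  \<open>h y = 0\<close>.\<close>

definition log_concave_on :: "'a::real_vector set \<Rightarrow> ('a \<Rightarrow> real) \<Rightarrow> bool" where
  "log_concave_on D h \<longleftrightarrow> convex D \<and> (\<forall>x\<in>D. 0 \<le> h x) \<and>
     (\<forall>x\<in>D. \<forall>y\<in>D. \<forall>\<theta>\<in>{0<..<1}.
        h (\<theta> *\<^sub>R x + (1 - \<theta>) *\<^sub>R y) \<ge> h x powr \<theta> * h y powr (1 - \<theta>))"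

definition log_convex_on :: "real set \<Rightarrow> (real \<Rightarrow> real) \<Rightarrow> bool" where
  "log_convex_on I h \<longleftrightarrow> (\<forall>x\<in>I. 0 < h x) \<and> convex_on I (\<lambda>x. ln (h x))"

end

theory Submission
  imports Defs "HOL-Real_Asymp.Real_Asymp"
begin

text \<open>Put \<open>w = A\<^sup>-\<^sup>1(y - \<mu>)\<close>, \<open>c = A\<^sup>-\<^sup>1\<beta>\<close>, \<open>k = |c|\<close> and \<open>h = g*\<close>. Expanding the square, \<open>f\<close> is a constant times
  \<open>exp (w \<bullet> c) Q(|w|)\<close> with \<open>Q(r) = \<integral> x powr (-1/2) exp (- r\<^sup>2/(2x) - k\<^sup>2x/2) h(x) dx\<close>, a strictly decreasing
  function, so everything reduces to the one-dimensional \<open>Q\<close>. For \<open>d > 0\<close> the integral of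
  \<open>x powr (-1/2) exp (- r\<^sup>2/(2x) - d\<^sup>2x/2)\<close> is proportional to \<open>exp (- d r)\<close>, hence
  \<open>exp (d r) Q(r) - V\<close> is a positive multiple of \<open>\<integral> exp (- r\<^sup>2/(2x)) \<psi>(x) dx\<close>, where \<open>\<psi>\<close> has the sign of
  \<open>exp ((d\<^sup>2 - k\<^sup>2)x/2) h(x) - a\<close>. The kernel \<open>exp (- s/x)\<close> is strictly totally positive, so if this sign is
  positive exactly on an interval, then the integral is positive between any two points where it is
  nonnegative. With \<open>d = k\<close> this makes \<open>exp (k r) Q(r)\<close> strictly quasiconcave for unimodal \<open>h\<close>. If \<open>h\<close> is
  log-concave or log-convex, then taking for \<open>- d\<close> the slope of an arbitrary chord of \<open>ln Q\<close> shows that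
  \<open>ln Q\<close> is concave or convex.\<close>

section \<open>Exponential pencils and the sign of Laplace-type integrals\<close>

text \<open>The derivative is strictly increasing, so the mean value theorem on the two subintervals
  compares the slopes of adjacent chords. Denominators are cleared.\<close>

lemma exp_sum_strictly_convex:
  fixes \<alpha> \<gamma> p q a b c :: real
  defines "E \<equiv> \<lambda>y. \<alpha> * exp (p * y) + \<gamma> * exp (- (q * y))"
  assumes "a < b" "b < c" "p > 0" "q > 0" "\<alpha> \<ge> 0" "\<gamma> \<ge> 0" "\<alpha> + \<gamma> > 0"
  shows "E b * (c - a) < E a * (c - b) + E c * (b - a)"
proof -
  define E' where "E' = (\<lambda>y. \<alpha> * p * exp (p * y) - \<gamma> * q * exp (- (q * y)))"
  have D: "(E has_real_derivative E' y) (at y)" for y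
    unfolding E_def E'_def by (auto intro!: derivative_eq_intros simp: algebra_simps)
  obtain z where z: "a < z" "z < b" "E b - E a = (b - a) * E' z"
    using MVT2[OF \<open>a < b\<close> D] by blast
  obtain z' where z': "b < z'" "z' < c" "E c - E b = (c - b) * E' z'"
    using MVT2[OF \<open>b < c\<close> D] by blast
  have zz: "z < z'" using z z' by simp
  have "E' z < E' z'"
  proof -
    have 1: "exp (p * z) < exp (p * z')" "exp (- (q * z')) < exp (- (q * z))"
      using zz assms by auto
    have "\<alpha> > 0 \<or> \<gamma> > 0" using assms by linarith
    then show ?thesis
    proof
      assume "\<alpha> > 0"
      then have "\<alpha> * p * exp (p * z) < \<alpha> * p * exp (p * z')"
        using 1 \<open>p > 0\<close> by simp
      moreover have "\<gamma> * q * exp (- (q * z')) \<le> \<gamma> * q * exp (- (q * z))"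
        using 1 assms by (intro mult_left_mono) auto
      ultimately show ?thesis unfolding E'_def by linarith
    next
      assume "\<gamma> > 0"
      then have "\<gamma> * q * exp (- (q * z')) < \<gamma> * q * exp (- (q * z))"
        using 1 \<open>q > 0\<close> by simp
      moreover have "\<alpha> * p * exp (p * z) \<le> \<alpha> * p * exp (p * z')"
        using 1 assms by (intro mult_left_mono) auto
      ultimately show ?thesis unfolding E'_def by linarith
    qed
  qed
  then have "(b - a) * (c - b) * E' z < (b - a) * (c - b) * E' z'"
    using assms by (intro mult_strict_left_mono) auto
  then have "(c - b) * (E b - E a) < (b - a) * (E c - E b)"
    by (simp add: z z' mult.assoc mult.left_commute)
  then show ?thesis by (simp add: algebra_simps)
qed

text \<open>An interval is the positivity set of a member of the pencil
  \<open>1 - \<alpha> exp (p y) - \<gamma> exp (- q y)\<close>, up to finitely many points: this function is strictly concave,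
  so it suffices to let it vanish at the endpoints.\<close>

lemma exp_pencil_sign:
  fixes p q :: real and J :: "real set"
  assumes pq: "p > 0" "q > 0" and J: "J \<subseteq> {0<..}"
    and conv: "\<And>a b x. a \<in> J \<Longrightarrow> b \<in> J \<Longrightarrow> a \<le> x \<Longrightarrow> x \<le> b \<Longrightarrow> x \<in> J"
  obtains \<alpha> \<gamma> and Z :: "real set" where "\<alpha> \<ge> 0" "\<gamma> \<ge> 0" "finite Z"
    "\<And>y. y > 0 \<Longrightarrow> y \<notin> Z \<Longrightarrow> y \<in> J \<Longrightarrow> \<alpha> * exp (p * y) + \<gamma> * exp (- (q * y)) < 1"
    "\<And>y. y > 0 \<Longrightarrow> y \<notin> Z \<Longrightarrow> y \<notin> J \<Longrightarrow> \<alpha> * exp (p * y) + \<gamma> * exp (- (q * y)) > 1"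
proof (cases "\<exists>l. J \<subseteq> {l}")
  case True
  then obtain l where "J \<subseteq> {l}" by blast
  \<comment> \<open>At most one point lies in \<open>J\<close>, so the exponential sum has to exceed
    1 elsewhere; \<open>exp (p * y)\<close> does so for every positive \<open>y\<close>, and
    \<open>l\<close> is made exceptional.\<close>
  then show ?thesis using pq by (intro that[of 1 0 "{l}"]) auto
next
  case False
  then have "J \<noteq> {}" by auto
  have bdd: "bdd_below J" using J by (intro bdd_belowI[of _ 0]) auto
  define l where "l = Inf J"
  have l_out: "y \<notin> J" if "y < l" for y
    using cInf_lower[OF _ bdd] that unfolding l_def by force
  show ?thesis
  proof (cases "bdd_above J")
    case False
    have l_in: "y \<in> J" if ly: "l < y" for y
    proof -
      obtain a where "a \<in> J" "a < y"
        using cInf_less_iff[OF \<open>J \<noteq> {}\<close> bdd, of y] ly unfolding l_def by blast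
      moreover obtain b where "b \<in> J" "y \<le> b"
        using False by (meson bdd_aboveI2 bdd_above.unfold le_cases)
      ultimately show ?thesis using conv[of a b y] by simp
    qed
    \<comment> \<open>Only the left endpoint is finite here, so one decreasing exponential,
      normalised to equal 1 at \<open>l\<close>, suffices.\<close>
    have "exp (q * l) * exp (- (q * y)) = exp (q * (l - y))" for y
      by (simp add: mult_exp_exp algebra_simps)
    moreover have "y \<in> J \<longleftrightarrow> l < y" if "y \<noteq> l" for y
      using that l_out[of y] l_in[of y] by linarith
    ultimately show ?thesis using pq
      by (intro that[of 0 "exp (q * l)" "{l}"]) (simp_all add: mult_less_0_iff zero_less_mult_iff)
  next
    case True
    define r where "r = Sup J"
    have r_out: "y \<notin> J" if "r < y" for y
      using cSup_upper[OF _ True] that unfolding r_def by force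
    have lr_in: "y \<in> J" if lyr: "l < y" "y < r" for y
    proof -
      obtain a where "a \<in> J" "a < y"
        using cInf_less_iff[OF \<open>J \<noteq> {}\<close> bdd, of y] lyr unfolding l_def by blast
      moreover obtain b where "b \<in> J" "y < b"
        using less_cSup_iff[OF \<open>J \<noteq> {}\<close> True, of y] lyr unfolding r_def by blast
      ultimately show ?thesis using conv[of a b y] by simp
    qed
    have "l < r"
    proof (rule ccontr)
      assume "\<not> l < r"
      then have "J \<subseteq> {l}" using l_out r_out by (force simp: not_less)
      with \<open>\<not> (\<exists>l. J \<subseteq> {l})\<close> show False by blast
    qed
    \<comment> \<open>Cramer's rule for the two linear equations saying that the exponential sum
      equals 1 at \<open>l\<close> and at \<open>r\<close>.\<close>
    define D where "D = exp (p * r - q * l) - exp (p * l - q * r)"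
    define \<alpha> where "\<alpha> = (exp (- (q * l)) - exp (- (q * r))) / D"
    define \<gamma> where "\<gamma> = (exp (p * r) - exp (p * l)) / D"
    have "p * l < p * r" "q * l < q * r" using pq \<open>l < r\<close> by auto
    then have "D > 0" unfolding D_def by simp
    then have \<alpha>\<gamma>: "\<alpha> > 0" "\<gamma> > 0" unfolding \<alpha>_def \<gamma>_def
      using \<open>p * l < p * r\<close> \<open>q * l < q * r\<close> by simp_all
    define E where "E = (\<lambda>y. \<alpha> * exp (p * y) + \<gamma> * exp (- (q * y)))"
    have El: "E l = 1" and Er: "E r = 1"
      using \<open>D > 0\<close> unfolding E_def \<alpha>_def \<gamma>_def
      by (simp_all add: divide_simps) (simp_all add: D_def exp_diff exp_minus field_simps)
    have cvx: "E b * (c - a) < E a * (c - b) + E c * (b - a)" if "a < b" "b < c" for a b c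
      unfolding E_def using exp_sum_strictly_convex[OF that pq] \<alpha>\<gamma> by simp
    have "E y < 1" if "l < y" "y < r" for y
    proof -
      have "E y * (r - l) < 1 * (r - l)" using cvx[OF that] El Er by simp
      then show ?thesis using \<open>l < r\<close> by (simp only: mult_less_cancel_right_disj) simp
    qed
    moreover have "E y > 1" if "y < l" for y
    proof -
      have "1 * (r - l) < E y * (r - l)" using cvx[OF that \<open>l < r\<close>] El Er by simp
      then show ?thesis using \<open>l < r\<close> by (simp only: mult_less_cancel_right_disj) simp
    qed
    moreover have "E y > 1" if "r < y" for y
    proof -
      have "1 * (r - l) < E y * (r - l)" using cvx[OF \<open>l < r\<close> that] El Er by simp
      then show ?thesis using \<open>l < r\<close> by (simp only: mult_less_cancel_right_disj) simp
    qed
    moreover have "y \<in> J \<longleftrightarrow> l < y \<and> y < r" if "y \<notin> {l, r}" for y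
      using that l_out[of y] r_out[of y] lr_in[of y] linorder_neqE_linordered_idom[of y l]
        linorder_neqE_linordered_idom[of y r] by auto
    ultimately have "if y \<in> J then E y < 1 else E y > 1" if "y \<notin> {l, r}" for y
      using that by force
    then show ?thesis using \<alpha>\<gamma> unfolding E_def
      by (intro that[of \<alpha> \<gamma> "{l, r}"]) auto
  qed
qed

text \<open>For suitable nonnegative \<alpha> and \<gamma>, the combination
  \<open>E s - \<alpha> * E s1 - \<gamma> * E s2\<close> is the integral of
  \<open>exp (- (s / x)) * P x * \<psi> x\<close>, where \<open>P\<close> shares the sign of \<psi>
  off a finite set. The integral is therefore nonnegative, and it vanishes only if \<psi> does
  almost everywhere.\<close>

lemma integral_exp_sign_regular:
  fixes \<psi> :: "real \<Rightarrow> real" and s1 s s2 :: real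
  defines "E \<equiv> \<lambda>s. LINT x|lborel. exp (- (s / x)) * \<psi> x"
  assumes s: "s1 < s" "s < s2"
    and int: "\<And>\<sigma>. \<sigma> \<in> {s1, s, s2} \<Longrightarrow> integrable lborel (\<lambda>x. exp (- (\<sigma> / x)) * \<psi> x)"
    and supp: "\<And>x. x \<le> 0 \<Longrightarrow> \<psi> x = 0"
    and conv: "\<And>a b x. \<psi> a > 0 \<Longrightarrow> \<psi> b > 0 \<Longrightarrow> a \<le> x \<Longrightarrow> x \<le> b \<Longrightarrow> \<psi> x > 0"
    and ge: "E s1 \<ge> 0" "E s2 \<ge> 0"
  shows "E s \<ge> 0" and "\<not> (AE x in lborel. \<psi> x = 0) \<Longrightarrow> E s > 0"
proof -
  \<comment> \<open>The variable \<open>y = 1 / x\<close> turns the kernel into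
    \<open>exp (- s * y)\<close> and maps intervals of positive reals to intervals.\<close>
  define J where "J = {y. y > 0 \<and> \<psi> (1 / y) > 0}"
  have Jc: "x \<in> J" if "a \<in> J" "b \<in> J" "a \<le> x" "x \<le> b" for a b x
  proof -
    have "x > 0" using that by (auto simp: J_def)
    moreover have "1 / b \<le> 1 / x" "1 / x \<le> 1 / a"
      using that \<open>x > 0\<close> by (auto simp: J_def frac_le)
    ultimately show ?thesis using conv[of "1/b" "1/a" "1/x"] that by (auto simp: J_def)
  qed
  have J0: "0 < s - s1" "0 < s2 - s" "J \<subseteq> {0<..}" using s by (auto simp: J_def)
  obtain \<alpha> \<gamma> Z where \<alpha>\<gamma>: "\<alpha> \<ge> 0" "\<gamma> \<ge> 0" "finite Z"
    and in': "\<And>y. y > 0 \<Longrightarrow> y \<notin> Z \<Longrightarrow> y \<in> J \<Longrightarrow> \<alpha> * exp ((s - s1) * y) + \<gamma> * exp (- ((s2 - s) * y)) < 1"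
    and out: "\<And>y. y > 0 \<Longrightarrow> y \<notin> Z \<Longrightarrow> y \<notin> J \<Longrightarrow> \<alpha> * exp ((s - s1) * y) + \<gamma> * exp (- ((s2 - s) * y)) > 1"
    by (rule exp_pencil_sign[OF J0], erule (3) Jc, blast)
  \<comment> \<open>What remains of the combination of the three kernels once
    \<open>exp (- (s / x))\<close> is factored out; this is why the pencil has the exponents
    \<open>s - s1\<close> and \<open>s2 - s\<close>.\<close>
  define P where "P x = 1 - \<alpha> * exp ((s - s1) / x) - \<gamma> * exp (- ((s2 - s) / x))" for x
  define N where "N = (\<lambda>y. 1 / y) ` Z"
  have "finite N" using \<alpha>\<gamma> by (simp add: N_def)
  have AE_N: "AE x in lborel. x \<notin> N"
    using \<open>finite N\<close> by (intro AE_not_in finite_imp_null_set_lborel)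
  have sgn: "0 \<le> exp (- (s / x)) * P x * \<psi> x" "exp (- (s / x)) * P x * \<psi> x = 0 \<Longrightarrow> \<psi> x = 0"
    if "x \<notin> N" for x
  proof -
    consider "x \<le> 0" | "x > 0" "\<psi> x > 0" | "x > 0" "\<psi> x \<le> 0" by linarith
    then have "0 \<le> P x * \<psi> x \<and> (P x * \<psi> x = 0 \<longrightarrow> \<psi> x = 0)"
    proof cases
      case 1 then show ?thesis using supp by simp
    next
      case 2
      have "1 / x \<notin> Z" using that 2 by (force simp: N_def)
      then have "P x > 0" using in'[of "1/x"] 2 by (simp add: J_def P_def)
      then show ?thesis using 2 by simp
    next
      case 3
      have "1 / x \<notin> Z" using that 3 by (force simp: N_def)
      then have "P x < 0" using out[of "1/x"] 3 by (simp add: J_def P_def)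
      then show ?thesis using 3 by (auto simp: zero_le_mult_iff)
    qed
    then show "0 \<le> exp (- (s / x)) * P x * \<psi> x" "exp (- (s / x)) * P x * \<psi> x = 0 \<Longrightarrow> \<psi> x = 0"
      by (auto simp: mult.assoc)
  qed
  have eq: "exp (- (s / x)) * P x * \<psi> x = exp (- (s / x)) * \<psi> x
      - \<alpha> * (exp (- (s1 / x)) * \<psi> x) - \<gamma> * (exp (- (s2 / x)) * \<psi> x)" for x
    unfolding P_def by (simp add: algebra_simps diff_divide_distrib add_divide_distrib mult_exp_exp flip: exp_add)
  have int': "integrable lborel (\<lambda>x. exp (- (s / x)) * P x * \<psi> x)"
    unfolding eq using int by (intro Bochner_Integration.integrable_diff integrable_mult_right) auto
  have val: "(LINT x|lborel. exp (- (s / x)) * P x * \<psi> x) = E s - \<alpha> * E s1 - \<gamma> * E s2"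
    unfolding eq E_def using int
    by (subst Bochner_Integration.integral_diff Bochner_Integration.integral_mult_right,
        auto intro!: Bochner_Integration.integrable_diff integrable_mult_right)+
  have nn: "AE x in lborel. 0 \<le> exp (- (s / x)) * P x * \<psi> x"
    using AE_N sgn(1) by auto
  have ge0: "0 \<le> (LINT x|lborel. exp (- (s / x)) * P x * \<psi> x)"
    using nn by (rule integral_nonneg_AE)
  have c: "0 \<le> \<alpha> * E s1" "0 \<le> \<gamma> * E s2" using \<alpha>\<gamma> ge by auto
  show "E s \<ge> 0" using ge0 val c by linarith
  assume ns: "\<not> (AE x in lborel. \<psi> x = 0)"
  show "E s > 0"
  proof (rule ccontr)
    assume "\<not> E s > 0"
    then have "(LINT x|lborel. exp (- (s / x)) * P x * \<psi> x) = 0" using ge0 val c by linarith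
    then have "AE x in lborel. exp (- (s / x)) * P x * \<psi> x = 0"
      using integral_nonneg_eq_0_iff_AE[OF int' nn] by simp
    then have "AE x in lborel. \<psi> x = 0" using AE_N sgn(2) by auto
    with ns show False by contradiction
  qed
qed

section \<open>The integral of the Gaussian kernel over the mixing variable\<close>

text \<open>To the right of \<open>a\<close> the distribution function is a constant plus the
  integral of a continuous density. Starting at \<open>a = x - 1\<close> keeps \<open>x\<close> in
  the interior of the interval, so the derivative obtained is two-sided.\<close>

lemma std_normal_cdf_deriv:
  "(cdf (density lborel std_normal_density) has_real_derivative std_normal_density x) (at x)"
proof -
  interpret real_distribution "density lborel std_normal_density"
    by (rule real_dist_normal_dist)
  let ?M = "density lborel std_normal_density"
  define a where "a = x - 1"
  have cont: "continuous_on S std_normal_density" for S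
    unfolding std_normal_density_def by (intro continuous_intros) auto
  have eq: "cdf ?M y = cdf ?M a + integral {a..y} std_normal_density" if "y \<ge> a" for y
  proof -
    have "cdf ?M y - cdf ?M a = integral {a..y} std_normal_density"
    proof (cases "y = a")
      case False
      then have "a < y" using that by simp
      have "cdf ?M y - cdf ?M a = measure ?M {a<..y}" using cdf_diff_eq[OF \<open>a < y\<close>] by simp
      also have "\<dots> = (LINT z|lborel. indicator {a<..y} z * std_normal_density z)"
        unfolding measure_def
        by (subst emeasure_density) (auto simp: enn2real_nn_integral_eq_integral
            integral_eq_nn_integral mult.commute ennreal_mult' ennreal_indicator intro!: arg_cong[where f=enn2real] nn_integral_cong split: split_indicator)
      also have "\<dots> = (LINT z:{a..y}|lborel. std_normal_density z)"
        unfolding set_lebesgue_integral_def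
        by (intro integral_cong_AE) (use AE_lborel_singleton[of a] in \<open>auto split: split_indicator\<close>)
      also have "\<dots> = integral {a..y} std_normal_density"
        by (intro set_borel_integral_eq_integral borel_integrable_atLeastAtMost' cont)
      finally show ?thesis .
    qed simp
    then show ?thesis by simp
  qed
  have "((\<lambda>y. integral {a..y} std_normal_density) has_real_derivative std_normal_density x)
      (at x within {a..x+1})"
    by (rule integral_has_real_derivative[OF cont]) (simp add: a_def)
  moreover have "at x within {a..x+1} = at x"
    by (rule at_within_interior) (simp add: a_def)
  ultimately have "((\<lambda>y. cdf ?M a + integral {a..y} std_normal_density) has_real_derivative std_normal_density x) (at x)"
    by (auto intro!: derivative_eq_intros)
  moreover have "\<forall>\<^sub>F y in nhds x. y \<in> {a<..}"
    by (intro eventually_nhds_in_open) (auto simp: a_def)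
  then have "\<forall>\<^sub>F y in nhds x. cdf ?M y = cdf ?M a + integral {a..y} std_normal_density"
    by (rule eventually_mono) (rule eq, simp)
  ultimately show ?thesis by (subst DERIV_cong_ev[OF refl _ refl])
qed

text \<open>The antiderivative is the distribution function of the last passage time at level \<open>r\<close> of a
  Brownian motion with drift \<open>d\<close>.\<close>

lemma integral_gaussian_kernel:
  fixes r d :: real
  assumes "r > 0" "d > 0"
  defines "k \<equiv> \<lambda>x. indicator {0<..} x * (x powr (-1/2) * exp (- (r\<^sup>2 / (2 * x)) - d\<^sup>2 * x / 2))"
  shows "integrable lborel k" "(LINT x|lborel. k x) = sqrt (2 * pi) / d * exp (- (d * r))"
proof -
  let ?M = "density lborel std_normal_density"
  interpret real_distribution ?M by (rule real_dist_normal_dist)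
  define \<Phi> where "\<Phi> = cdf ?M"
  define F where "F x = \<Phi> ((d * x - r) / sqrt x) - exp (2 * d * r) * \<Phi> (- (d * x + r) / sqrt x)" for x
  define f where "f x = d / sqrt (2 * pi) * exp (d * r) * (x powr (-1/2) * exp (- (r\<^sup>2 / (2 * x)) - d\<^sup>2 * x / 2))" for x
  have D\<Phi>: "(\<Phi> has_real_derivative std_normal_density x) (at x)" for x
    unfolding \<Phi>_def by (rule std_normal_cdf_deriv)
  have top: "(\<Phi> \<longlongrightarrow> 1) at_top" and bot: "(\<Phi> \<longlongrightarrow> 0) at_bot"
    unfolding \<Phi>_def by (rule cdf_lim_at_top_prob, rule cdf_lim_at_bot)
  have DF: "(F has_real_derivative f x) (at x)" if "x > 0" for x
  proof -
    define n where "n = std_normal_density ((d * x - r) / sqrt x)"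
    \<comment> \<open>Since \<open>(d x + r)^2 = (d x - r)^2 + 4 d x r\<close>, the factor
      \<open>exp (2 * d * r)\<close> equalises the two Gaussian values. In the derivative of
      \<open>F\<close> the terms with \<open>r\<close> then cancel.\<close>
    have n': "exp (2 * d * r) * std_normal_density (- (d * x + r) / sqrt x) = n"
      using that unfolding n_def std_normal_density_def
      by (simp add: power_divide field_simps power2_eq_square flip: exp_add)
    have n'': "n * (d / sqrt x) = f x"
      using that assms unfolding n_def std_normal_density_def f_def
      by (simp add: power_divide powr_minus powr_half_sqrt field_simps power2_eq_square flip: exp_add)
    have 1: "((\<lambda>x. (d * x - r) / sqrt x) has_real_derivative (d / (2 * sqrt x) + r / (2 * x * sqrt x))) (at x)"
      using that by (auto intro!: derivative_eq_intros simp: field_simps)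
    have 2: "((\<lambda>x. - (d * x + r) / sqrt x) has_real_derivative (- d / (2 * sqrt x) + r / (2 * x * sqrt x))) (at x)"
      using that by (auto intro!: derivative_eq_intros simp: field_simps)
    have "(F has_real_derivative (n * (d / (2 * sqrt x) + r / (2 * x * sqrt x))
        - exp (2 * d * r) * (std_normal_density (- (d * x + r) / sqrt x) * (- d / (2 * sqrt x) + r / (2 * x * sqrt x))))) (at x)"
      unfolding F_def n_def
      by (intro DERIV_diff DERIV_cmult DERIV_chain2[OF D\<Phi>] 1 2)
    also have "n * (d / (2 * sqrt x) + r / (2 * x * sqrt x))
        - exp (2 * d * r) * (std_normal_density (- (d * x + r) / sqrt x) * (- d / (2 * sqrt x) + r / (2 * x * sqrt x)))
      = n * (d / sqrt x)"
      unfolding mult.assoc[symmetric] n' by (simp add: algebra_simps)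
    finally show ?thesis unfolding n'' .
  qed
  have contf: "isCont f x" if "x > 0" for x
    using that unfolding f_def by (auto intro!: continuous_intros)
  have f0: "0 \<le> f x" for x using assms by (simp add: f_def)
  \<comment> \<open>As \<open>r > 0\<close>, both arguments of \<Phi> tend to minus infinity at 0.
    At infinity the first tends to plus infinity and the second to minus infinity, so
    \<open>F\<close> climbs from 0 to 1.\<close>
  have "(F \<longlongrightarrow> 0 - exp (2 * d * r) * 0) (at_right 0)"
    unfolding F_def
    by (intro tendsto_intros filterlim_compose[OF bot]; use assms in real_asymp)
  then have A: "((F \<circ> real_of_ereal) \<longlongrightarrow> 0) (at_right 0)"
    by (simp add: ereal_tendsto_simps1 zero_ereal_def)
  have "(F \<longlongrightarrow> 1 - exp (2 * d * r) * 0) at_top"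
    unfolding F_def
    by (intro tendsto_intros filterlim_compose[OF bot] filterlim_compose[OF top]; use assms in real_asymp)
  then have B: "((F \<circ> real_of_ereal) \<longlongrightarrow> 1) (at_left \<infinity>)"
    by (simp add: ereal_tendsto_simps1)
  note ftc = interval_integral_FTC_nonneg[of 0 \<infinity> F f, OF _ _ _ _ A B]
  have e: "einterval 0 \<infinity> = {0::real<..}" by (auto simp: einterval_def zero_ereal_def)
  have i1: "set_integrable lborel {0<..} f"
    using ftc(1) DF contf f0 e by (auto simp: zero_ereal_def)
  have "(LBINT x=0..\<infinity>. f x) = 1"
    using ftc(2) DF contf f0 by (auto simp: zero_ereal_def)
  then have i2: "(LINT x:{0<..}|lborel. f x) = 1"
    by (simp add: interval_lebesgue_integral_def e)
  have kf: "k x = sqrt (2 * pi) / d * exp (- (d * r)) * (indicator {0<..} x *\<^sub>R f x)" for x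
    using assms unfolding k_def f_def by (auto simp: exp_minus split: split_indicator)
  show "integrable lborel k"
    unfolding kf using i1 unfolding set_integrable_def by (intro integrable_mult_right)
  show "(LINT x|lborel. k x) = sqrt (2 * pi) / d * exp (- (d * r))"
    unfolding kf using i2 unfolding set_lebesgue_integral_def
    by (subst Bochner_Integration.integral_mult_right_zero) simp
qed

section \<open>The radial part of the mixture density\<close>

text \<open>The exponent -1/2 is the same in every dimension: the remaining factor
  \<open>x powr (- (p - 1) / 2)\<close> of the Gaussian normalisation is absorbed into
  \<open>gstar\<close>.\<close>

definition radial_kernel :: "real \<Rightarrow> real \<Rightarrow> real \<Rightarrow> real" where
  "radial_kernel d r x = indicator {0<..} x * (x powr (-1/2) * exp (- (r\<^sup>2 / (2 * x)) - d\<^sup>2 * x / 2))"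

lemma radial_kernel_nonneg: "radial_kernel d r x \<ge> 0"
  by (simp add: radial_kernel_def)

lemma radial_kernel_pos: "x > 0 \<Longrightarrow> radial_kernel d r x > 0"
  by (simp add: radial_kernel_def)

lemma radial_kernel_eq_0: "x \<le> 0 \<Longrightarrow> radial_kernel d r x = 0"
  by (simp add: radial_kernel_def)

lemma radial_kernel_measurable [measurable]: "radial_kernel d r \<in> borel_measurable borel"
  unfolding radial_kernel_def by measurable

lemma radial_kernel_exp: "radial_kernel d r x = exp (- (r\<^sup>2 / 2 / x)) * radial_kernel d 0 x"
  by (simp add: radial_kernel_def mult.left_commute flip: exp_add)

text \<open>The drift enters only through \<open>exp (- d\<^sup>2 * x / 2)\<close>, so it can be
  changed at will at the price of an exponential tilt of the mixing function.\<close>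

lemma radial_kernel_tilt: "radial_kernel k r x = radial_kernel d r x * exp ((d\<^sup>2 - k\<^sup>2) * x / 2)"
  by (simp add: radial_kernel_def mult.assoc flip: exp_add) (simp add: field_simps)

lemma radial_kernel_strict_antimono:
  assumes "0 \<le> r" "r < r'" "x > 0"
  shows "radial_kernel d r' x < radial_kernel d r x"
proof -
  have "r\<^sup>2 < r'\<^sup>2" using assms by (simp add: power_strict_mono)
  then have "r\<^sup>2 / (2 * x) < r'\<^sup>2 / (2 * x)" using assms by (intro divide_strict_right_mono) auto
  then show ?thesis using assms by (simp add: radial_kernel_def)
qed

lemma radial_kernel_antimono:
  assumes "0 \<le> r" "r \<le> r'"
  shows "radial_kernel d r' x \<le> radial_kernel d r x"
  using radial_kernel_strict_antimono[of r r' x d] radial_kernel_eq_0[of x] assms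
  by (cases "x > 0"; cases "r = r'") (auto simp: less_imp_le)

lemma radial_kernel_isCont: "isCont (\<lambda>r. radial_kernel d r x) r"
  unfolding radial_kernel_def by (cases "x = 0") (auto intro!: continuous_intros)

text \<open>The right-hand side is the maximum over \<open>y\<close>, attained at
  \<open>y = b / a\<close>; it comes from \<open>ln t \<le> t - 1\<close> at
  \<open>t = y * a / b\<close>.\<close>

lemma powr_exp_bound:
  fixes a b y :: real
  assumes "a > 0" "b > 0" "y > 0"
  shows "y powr b * exp (- (a * y)) \<le> exp (b * ln (b / a) - b)"
proof -
  have "ln (y * (a / b)) \<le> y * (a / b) - 1" using assms by (intro ln_le_minus_one) auto
  then have "b * ln (y * (a / b)) \<le> b * (y * (a / b) - 1)" using assms by simp
  then have "b * ln y \<le> b * ln (b / a) + a * y - b"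
    using assms by (simp add: ln_mult ln_div algebra_simps)
  then show ?thesis using assms by (simp add: powr_def flip: exp_add)
qed

section \<open>Radial integrals of a mixing function: finiteness, strict monotonicity,
  continuity\<close>

definition radial_part :: "real \<Rightarrow> (real \<Rightarrow> real) \<Rightarrow> real \<Rightarrow> ennreal" where
  "radial_part k h r = (\<integral>\<^sup>+x. ennreal (radial_kernel k r x * h x) \<partial>lborel)"

text \<open>Here \<open>h\<close> stands for \<open>gstar p g\<close>. With
  \<open>q = (p - 1) / 2\<close>, \<open>h_int\<close> is the integrability of \<open>g\<close>, and
  \<open>h_nz\<close> says that \<open>g\<close> is not almost everywhere zero on the positive
  reals; \<open>k\<close> will be the norm of the standardized drift.\<close>

locale radial_mixture =
  fixes h :: "real \<Rightarrow> real" and q k :: real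
  assumes h_nonneg: "x > 0 \<Longrightarrow> h x \<ge> 0"
    and h_meas: "(\<lambda>x. indicator {0<..} x * h x) \<in> borel_measurable borel"
    and h_int: "integrable lborel (\<lambda>x. indicator {0<..} x * (x powr q * h x))"
    and h_nz: "\<not> (AE x in lborel. indicator {0<..} x * h x = 0)"
    and q: "q \<ge> 0" and k: "k \<ge> 0"
begin

abbreviation "rp \<equiv> radial_part k h"

text \<open>A divergent integral gets the default value 0. This can happen only at
  \<open>r = 0\<close>, where \<open>radial_part\<close> records the value infinity instead.\<close>

definition R :: "real \<Rightarrow> real" where "R r = (LINT x|lborel. radial_kernel k r x * h x)"

lemma kernel_h_nonneg: "radial_kernel d r x * h x \<ge> 0"
  using h_nonneg[of x] radial_kernel_nonneg[of d r x] radial_kernel_eq_0[of x d r] by (cases "x > 0") auto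

lemma kernel_h_measurable [measurable]: "(\<lambda>x. radial_kernel d r x * h x) \<in> borel_measurable borel"
proof -
  have "radial_kernel d r x * h x = radial_kernel d r x * (indicator {0<..} x * h x)" for x
    by (simp add: radial_kernel_def split: split_indicator)
  then have "(\<lambda>x. radial_kernel d r x * h x) = (\<lambda>x. radial_kernel d r x * (indicator {0<..} x * h x))" by blast
  also have "\<dots> \<in> borel_measurable borel"
    by (rule borel_measurable_times[OF radial_kernel_measurable h_meas])
  finally show ?thesis .
qed

text \<open>For \<open>r > 0\<close> the factor \<open>exp (- (r\<^sup>2 / (2 * x)))\<close> beats
  every negative power of \<open>x\<close> near 0. Hence the kernel is at most a multiple of
  \<open>x powr q\<close>, by \<open>powr_exp_bound\<close> at \<open>1 / x\<close> with exponent
  \<open>q + 1/2\<close>.\<close>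

lemma integrable_radial:
  assumes "r > 0"
  shows "integrable lborel (\<lambda>x. radial_kernel k r x * h x)"
proof -
  define B where "B = exp ((q + 1/2) * ln ((q + 1/2) / (r\<^sup>2 / 2)) - (q + 1/2))"
  have "radial_kernel k r x * h x \<le> B * (indicator {0<..} x * (x powr q * h x))" for x
  proof (cases "x > 0")
    case True
    have "x powr (-1/2) * exp (- (r\<^sup>2 / (2 * x))) = x powr q * ((1 / x) powr (q + 1/2) * exp (- (r\<^sup>2 / 2 * (1 / x))))"
      using True by (simp add: powr_divide powr_add powr_minus_divide)
    also have "\<dots> \<le> x powr q * B"
      unfolding B_def using powr_exp_bound[of "r\<^sup>2 / 2" "q + 1/2" "1 / x"] q assms True
      by (intro mult_left_mono) auto
    finally have "x powr (-1/2) * exp (- (r\<^sup>2 / (2 * x))) * exp (- (k\<^sup>2 * x / 2)) \<le> x powr q * B * 1"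
      by (rule mult_mono) (use True in \<open>auto simp: B_def\<close>)
    then have "radial_kernel k r x \<le> x powr q * B"
      using True by (simp add: radial_kernel_def mult.assoc flip: exp_add)
    from mult_right_mono[OF this h_nonneg[OF True]] show ?thesis
      using True by (simp add: mult.assoc mult.left_commute)
  qed (simp add: radial_kernel_def)
  then show ?thesis
    by (intro Bochner_Integration.integrable_bound[OF integrable_mult_right[OF h_int, of B]])
       (use kernel_h_nonneg in \<open>auto intro!: AE_I2 order_trans[OF _ abs_ge_self]\<close>)
qed

lemma radial_part_eq:
  assumes "integrable lborel (\<lambda>x. radial_kernel k r x * h x)"
  shows "rp r = ennreal (R r)"
  unfolding radial_part_def R_def
  by (rule nn_integral_eq_integral[OF assms]) (use kernel_h_nonneg in auto)

lemma integrable_iff_finite: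
  "integrable lborel (\<lambda>x. radial_kernel k r x * h x) \<longleftrightarrow> rp r < \<infinity>"
  unfolding radial_part_def integrable_iff_bounded using kernel_h_nonneg by simp

text \<open>A positive constant \<open>h\<close> would violate \<open>h_int\<close>, because
  \<open>x powr q \<ge> 1\<close> on the infinitely long set \<open>{1<..}\<close>. The lemma
  excludes the degenerate case of the strict sign arguments.\<close>

lemma not_AE_h_const:
  assumes "a \<ge> 0"
  shows "\<not> (AE x in lborel. x > 0 \<longrightarrow> h x = a)"
proof
  assume *: "AE x in lborel. x > 0 \<longrightarrow> h x = a"
  show False
  proof (cases "a = 0")
    case True
    then have "AE x in lborel. indicator {0<..} x * h x = 0"
      using * by (auto elim!: eventually_mono split: split_indicator)
    then show False using h_nz by contradiction
  next
    case False
    have m: "(\<lambda>x. indicator {0<..} x * (x powr q * a)) \<in> borel_measurable lborel" by measurable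
    have "integrable lborel (\<lambda>x. indicator {0<..} x * (x powr q * a))"
      using * by (intro integrable_cong_AE_imp[OF h_int m]) (auto elim!: eventually_mono split: split_indicator)
    then have "integrable lborel (\<lambda>x::real. indicator {1<..} x * a)"
    proof (rule Bochner_Integration.integrable_bound)
      have "a * 1 \<le> x powr q * a" if "x > 1" for x
        using ge_one_powr_ge_zero[of x q] that q assms mult_right_mono[of 1 "x powr q" a] by simp
      then show "AE x in lborel. norm (indicat_real {1<..} x * a) \<le> norm (indicator {0<..} x * (x powr q * a))"
        using assms by (auto intro!: AE_I2 split: split_indicator)
    qed simp
    then have "integrable lborel (indicator {1<..} :: real \<Rightarrow> real)"
      using False by (simp add: integrable_mult_left_iff)
    then have fin: "emeasure lborel {1::real<..} < \<infinity>" by (simp add: integrable_indicator_iff)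
    have "ennreal (real n) \<le> emeasure lborel {1::real<..}" for n
    proof -
      have "ennreal (real n) = emeasure lborel {1<..1 + real n}" by simp
      also have "\<dots> \<le> emeasure lborel {1::real<..}" by (intro emeasure_mono) auto
      finally show ?thesis .
    qed
    moreover obtain c where "emeasure lborel {1::real<..} = ennreal c" "c \<ge> 0"
      using fin by (cases "emeasure lborel {1::real<..}") auto
    ultimately have "real n \<le> c" for n using \<open>c \<ge> 0\<close> by (metis ennreal_le_iff)
    then show False using reals_Archimedean2[of c] by (meson not_le)
  qed
qed

lemma radial_part_pos: "rp r > 0"
proof -
  have "rp r \<noteq> 0"
  proof
    assume "rp r = 0"
    then have "AE x in lborel. radial_kernel k r x * h x \<le> 0"
      unfolding radial_part_def by (subst (asm) nn_integral_0_iff_AE) (auto simp: ennreal_eq_0_iff)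
    then have "AE x in lborel. x > 0 \<longrightarrow> h x = 0"
    proof (rule eventually_mono)
      fix x assume "radial_kernel k r x * h x \<le> 0"
      then show "x > 0 \<longrightarrow> h x = 0"
        using radial_kernel_pos[of x k r] h_nonneg[of x] by (auto simp: mult_le_0_iff)
    qed
    then show False using not_AE_h_const[of 0] by simp
  qed
  then show ?thesis by (simp add: zero_less_iff_neq_zero)
qed

lemma R_pos: "integrable lborel (\<lambda>x. radial_kernel k r x * h x) \<Longrightarrow> R r > 0"
  using radial_part_pos[of r] radial_part_eq[of r] by (simp add: ennreal_less_zero_iff)

lemma radial_part_eq_R: "r > 0 \<Longrightarrow> rp r = ennreal (R r)"
  by (intro radial_part_eq integrable_radial)

lemma R_pos': "r > 0 \<Longrightarrow> R r > 0"
  by (intro R_pos integrable_radial)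

text \<open>The kernel decreases strictly at each \<open>x > 0\<close>, so equal finite integrals
  would force \<open>h\<close> to vanish almost everywhere. If the value at \<open>r\<close> is
  infinite, the one at \<open>r' > 0\<close> is still finite.\<close>

lemma radial_part_strict_antimono:
  assumes "0 \<le> r" "r < r'"
  shows "rp r' < rp r"
proof (cases "rp r = \<infinity>")
  case True
  then show ?thesis using radial_part_eq_R[of r'] assms by simp
next
  case False
  then have i: "integrable lborel (\<lambda>x. radial_kernel k r x * h x)"
    unfolding integrable_iff_finite by (simp add: less_top)
  have i': "integrable lborel (\<lambda>x. radial_kernel k r' x * h x)"
    using assms by (intro integrable_radial) auto
  have le: "radial_kernel k r' x * h x \<le> radial_kernel k r x * h x" for x
    using radial_kernel_antimono[of r r' k x] assms h_nonneg[of x] radial_kernel_eq_0[of x]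
    by (cases "x > 0") (auto intro: mult_right_mono)
  have "R r' \<noteq> R r"
  proof
    assume "R r' = R r"
    then have "(LINT x|lborel. radial_kernel k r x * h x - radial_kernel k r' x * h x) = 0"
      using i i' by (simp add: R_def)
    then have "AE x in lborel. radial_kernel k r x * h x - radial_kernel k r' x * h x = 0"
      using i i' le by (subst (asm) integral_nonneg_eq_0_iff_AE) auto
    then have "AE x in lborel. x > 0 \<longrightarrow> h x = 0"
    proof (rule eventually_mono)
      fix x assume "radial_kernel k r x * h x - radial_kernel k r' x * h x = 0"
      then have "(radial_kernel k r x - radial_kernel k r' x) * h x = 0" by (simp add: algebra_simps)
      then show "x > 0 \<longrightarrow> h x = 0" using radial_kernel_strict_antimono[OF assms, of x k] by auto
    qed
    then show False using not_AE_h_const[of 0] by simp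
  qed
  moreover have "R r' \<le> R r" unfolding R_def using i i' le by (intro integral_mono) auto
  ultimately have "R r' < R r" by simp
  then show ?thesis using radial_part_eq[OF i] radial_part_eq[OF i'] R_pos[OF i']
    by (simp add: ennreal_less_iff)
qed

lemma R_strict_antimono: "0 < r \<Longrightarrow> r < r' \<Longrightarrow> R r' < R r"
  using radial_part_strict_antimono[of r r'] radial_part_eq_R[of r] radial_part_eq_R[of r'] R_pos'[of r']
  by (simp add: ennreal_less_iff)

text \<open>At 0 the limit may be infinite and a dominating function may be missing, so Fatou's
  lemma bounds from below and monotonicity from above. At \<open>a > 0\<close> the kernel at radius
  \<open>a / 2\<close> dominates.\<close>

lemma radial_part_continuous: "continuous_on {0..} rp"
proof (rule continuous_on_sequentiallyI)
  fix u :: "nat \<Rightarrow> real" and a assume u: "\<forall>n. u n \<in> {0..}" "a \<in> {0..}" "u \<longlonglongrightarrow> a"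
  have pw: "(\<lambda>n. ennreal (radial_kernel k (u n) x * h x)) \<longlonglongrightarrow> ennreal (radial_kernel k a x * h x)" for x
    using isCont_tendsto_compose[OF radial_kernel_isCont u(3)] by (intro tendsto_intros)
  have mono: "rp r' \<le> rp r" if "0 \<le> r" "r \<le> r'" for r r'
    using radial_part_strict_antimono[of r r'] that by (cases "r = r'") (auto intro: less_imp_le)
  show "(\<lambda>n. rp (u n)) \<longlonglongrightarrow> rp a"
  proof (cases "a = 0")
    case True
    have "rp a = (\<integral>\<^sup>+x. liminf (\<lambda>n. ennreal (radial_kernel k (u n) x * h x)) \<partial>lborel)"
      unfolding radial_part_def by (intro nn_integral_cong lim_imp_Liminf[symmetric] pw) simp
    also have "\<dots> \<le> liminf (\<lambda>n. rp (u n))"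
      unfolding radial_part_def by (intro nn_integral_liminf) measurable
    finally have "rp a \<le> liminf (\<lambda>n. rp (u n))" .
    moreover have "rp (u n) \<le> rp a" for n using mono[of 0 "u n"] u True by auto
    then have "limsup (\<lambda>n. rp (u n)) \<le> rp a" by (intro Limsup_bounded) auto
    ultimately show ?thesis
      using Liminf_le_Limsup[of sequentially "\<lambda>n. rp (u n)"]
      by (intro Liminf_eq_Limsup) (auto intro!: antisym intro: order_trans)
  next
    case False
    then have a: "a > 0" using u by simp
    then have "\<forall>\<^sub>F n in sequentially. u n > a / 2" using u(3) by (intro order_tendstoD) auto
    then obtain N where N: "\<And>n. n \<ge> N \<Longrightarrow> u n > a / 2" unfolding eventually_sequentially by auto
    have "(\<lambda>n. rp (u (n + N))) \<longlonglongrightarrow> rp a"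
      unfolding radial_part_def
    proof (rule nn_integral_dominated_convergence[where w = "\<lambda>x. ennreal (radial_kernel k (a / 2) x * h x)"])
      show "(\<integral>\<^sup>+x. ennreal (radial_kernel k (a / 2) x * h x) \<partial>lborel) < \<infinity>"
        using radial_part_eq_R[of "a/2"] a by (simp add: radial_part_def)
      show "AE x in lborel. (\<lambda>n. ennreal (radial_kernel k (u (n + N)) x * h x)) \<longlonglongrightarrow> ennreal (radial_kernel k a x * h x)"
        using LIMSEQ_ignore_initial_segment[OF pw] by simp
      show "AE x in lborel. ennreal (radial_kernel k (u (n + N)) x * h x) \<le> ennreal (radial_kernel k (a / 2) x * h x)" for n
      proof (intro AE_I2 ennreal_leI)
        fix x
        show "radial_kernel k (u (n + N)) x * h x \<le> radial_kernel k (a / 2) x * h x"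
          using radial_kernel_antimono[of "a/2" "u (n + N)" k x] N[of "n + N"] a h_nonneg[of x] radial_kernel_eq_0[of x]
          by (cases "x > 0") (auto intro: mult_right_mono)
      qed
    qed measurable
    then show ?thesis by (rule LIMSEQ_offset)
  qed
qed

section \<open>Sign regularity of the tilted radial integrals\<close>

lemma tilted_integral:
  fixes \<sigma> a d r
  assumes "d > 0" "r > 0"
  defines "\<psi> \<equiv> \<lambda>x. radial_kernel d 0 x * (\<sigma> * (exp ((d\<^sup>2 - k\<^sup>2) * x / 2) * h x - a))"
  shows "integrable lborel (\<lambda>x. exp (- (r\<^sup>2 / 2 / x)) * \<psi> x)"
    and "(LINT x|lborel. exp (- (r\<^sup>2 / 2 / x)) * \<psi> x) = \<sigma> * exp (- (d * r)) * (exp (d * r) * R r - a * (sqrt (2 * pi) / d))"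
proof -
  \<comment> \<open>The first term integrates to \<open>R r\<close>, and
    \<open>integral_gaussian_kernel\<close> evaluates the second: a constant level for
    \<open>h\<close> after the tilt becomes a constant level for
    \<open>exp (d * r) * R r\<close>.\<close>
  have eq: "exp (- (r\<^sup>2 / 2 / x)) * \<psi> x = \<sigma> * (radial_kernel k r x * h x - a * radial_kernel d r x)" for x
    unfolding \<psi>_def radial_kernel_exp[of d r] radial_kernel_tilt[of k r x d]
    by (simp add: algebra_simps)
  note g = integral_gaussian_kernel[OF \<open>r > 0\<close> \<open>d > 0\<close>, folded radial_kernel_def]
  have i: "integrable lborel (\<lambda>x. radial_kernel k r x * h x)" using assms by (intro integrable_radial)
  show "integrable lborel (\<lambda>x. exp (- (r\<^sup>2 / 2 / x)) * \<psi> x)"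
    unfolding eq using g i by auto
  have "(LINT x|lborel. exp (- (r\<^sup>2 / 2 / x)) * \<psi> x) = \<sigma> * (R r - a * (sqrt (2 * pi) / d * exp (- (d * r))))"
    unfolding eq using g i by (simp add: R_def)
  then show "(LINT x|lborel. exp (- (r\<^sup>2 / 2 / x)) * \<psi> x) = \<sigma> * exp (- (d * r)) * (exp (d * r) * R r - a * (sqrt (2 * pi) / d))"
    using exp_minus_inverse[of "d * r"] by algebra
qed

text \<open>The kernel \<open>exp (- s / x)\<close> occurs here with \<open>s = r^2 / 2\<close>,
  increasing in \<open>r > 0\<close>, so \<open>integral_exp_sign_regular\<close> applies to \<psi>
  at three radii. By \<open>tilted_integral\<close> its integral is a positive multiple of the
  quantity compared with 0.\<close>

lemma tilted_sign_regular:
  fixes \<sigma> a d r1 r r2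
  assumes d: "d > 0" and r: "0 < r1" "r1 < r" "r < r2"
    and conv: "\<And>u v x. 0 < u \<Longrightarrow> u \<le> x \<Longrightarrow> x \<le> v \<Longrightarrow> 0 < \<sigma> * (exp ((d\<^sup>2 - k\<^sup>2) * u / 2) * h u - a)
      \<Longrightarrow> 0 < \<sigma> * (exp ((d\<^sup>2 - k\<^sup>2) * v / 2) * h v - a) \<Longrightarrow> 0 < \<sigma> * (exp ((d\<^sup>2 - k\<^sup>2) * x / 2) * h x - a)"
    and ge: "0 \<le> \<sigma> * (exp (d * r1) * R r1 - a * (sqrt (2 * pi) / d))"
      "0 \<le> \<sigma> * (exp (d * r2) * R r2 - a * (sqrt (2 * pi) / d))"
  shows "0 \<le> \<sigma> * (exp (d * r) * R r - a * (sqrt (2 * pi) / d))"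
    and "\<not> (AE x in lborel. x > 0 \<longrightarrow> \<sigma> * (exp ((d\<^sup>2 - k\<^sup>2) * x / 2) * h x - a) = 0) \<Longrightarrow>
      0 < \<sigma> * (exp (d * r) * R r - a * (sqrt (2 * pi) / d))"
proof -
  define \<psi> where "\<psi> = (\<lambda>x. radial_kernel d 0 x * (\<sigma> * (exp ((d\<^sup>2 - k\<^sup>2) * x / 2) * h x - a)))"
  have t: "integrable lborel (\<lambda>x. exp (- (\<rho>\<^sup>2 / 2 / x)) * \<psi> x)"
      "(LINT x|lborel. exp (- (\<rho>\<^sup>2 / 2 / x)) * \<psi> x)
        = \<sigma> * exp (- (d * \<rho>)) * (exp (d * \<rho>) * R \<rho> - a * (sqrt (2 * pi) / d))" if "\<rho> > 0" for \<rho>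
    unfolding \<psi>_def by (rule tilted_integral[OF d that])+
  define s where "s = (\<lambda>r::real. r\<^sup>2 / 2)"
  have s: "s r1 < s r" "s r < s r2" unfolding s_def using r by (auto simp: power_strict_mono)
  have int: "integrable lborel (\<lambda>x. exp (- (\<rho> / x)) * \<psi> x)" if \<rho>: "\<rho> \<in> {s r1, s r, s r2}" for \<rho>
  proof -
    obtain u where u: "u \<in> {r1, r, r2}" "\<rho> = s u" using \<rho> by blast
    then have "u > 0" using r by auto
    then show ?thesis unfolding u(2) s_def by (rule t(1))
  qed
  have val: "(LINT x|lborel. exp (- (s \<rho> / x)) * \<psi> x)
      = exp (- (d * \<rho>)) * (\<sigma> * (exp (d * \<rho>) * R \<rho> - a * (sqrt (2 * pi) / d)))" if "\<rho> > 0" for \<rho>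
    unfolding s_def t(2)[OF that] by simp
  have supp: "\<psi> x = 0" if "x \<le> 0" for x using that by (simp add: \<psi>_def radial_kernel_eq_0)
  have pos: "\<psi> x > 0 \<longleftrightarrow> x > 0 \<and> 0 < \<sigma> * (exp ((d\<^sup>2 - k\<^sup>2) * x / 2) * h x - a)" for x
  proof (cases "x > 0")
    case True
    have "0 < radial_kernel d 0 x * y \<longleftrightarrow> 0 < y" for y
      using radial_kernel_pos[OF True, of d 0] by (simp add: zero_less_mult_iff)
    then show ?thesis using True by (simp add: \<psi>_def)
  qed (use supp[of x] in auto)
  have conv': "\<psi> x > 0" if "\<psi> u > 0" "\<psi> v > 0" "u \<le> x" "x \<le> v" for u v x
    using that conv[of u x v] unfolding pos by auto
  have ge': "0 \<le> (LINT x|lborel. exp (- (s r1 / x)) * \<psi> x)" "0 \<le> (LINT x|lborel. exp (- (s r2 / x)) * \<psi> x)"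
    using ge r by (simp_all add: val)
  note reg = integral_exp_sign_regular[OF s _ _ _ ge']
  have "r > 0" using r by simp
  show "0 \<le> \<sigma> * (exp (d * r) * R r - a * (sqrt (2 * pi) / d))"
  proof -
    have "0 \<le> (LINT x|lborel. exp (- (s r / x)) * \<psi> x)"
      by (rule reg(1), erule int, erule supp, erule (3) conv')
    then show ?thesis unfolding val[OF \<open>r > 0\<close>] by (simp add: zero_le_mult_iff)
  qed
  assume nz: "\<not> (AE x in lborel. x > 0 \<longrightarrow> \<sigma> * (exp ((d\<^sup>2 - k\<^sup>2) * x / 2) * h x - a) = 0)"
  have "\<not> (AE x in lborel. \<psi> x = 0)"
  proof
    assume "AE x in lborel. \<psi> x = 0"
    then have "AE x in lborel. x > 0 \<longrightarrow> \<sigma> * (exp ((d\<^sup>2 - k\<^sup>2) * x / 2) * h x - a) = 0"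
    proof (rule eventually_mono)
      fix x assume "\<psi> x = 0"
      then show "x > 0 \<longrightarrow> \<sigma> * (exp ((d\<^sup>2 - k\<^sup>2) * x / 2) * h x - a) = 0"
        using radial_kernel_pos[of x d 0] unfolding \<psi>_def by (metis less_irrefl mult_eq_0_iff)
    qed
    with nz show False by contradiction
  qed
  then have "0 < (LINT x|lborel. exp (- (s r / x)) * \<psi> x)"
    by - (rule reg(2), erule int, erule supp, erule (3) conv')
  then show "0 < \<sigma> * (exp (d * r) * R r - a * (sqrt (2 * pi) / d))"
    unfolding val[OF \<open>r > 0\<close>] by (rule zero_less_mult_pos) simp
qed

text \<open>The choice \<open>d = k\<close> removes the tilt, and superlevel sets of a quasiconcave
  \<open>h\<close> are intervals. The level \<open>a\<close> corresponds to the smaller endpoint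
  value; strictness holds as \<open>h\<close> is not almost everywhere equal to
  \<open>a\<close>.\<close>

lemma ray_density_strictly_quasiconcave:
  assumes k: "k > 0" and r: "0 < r1" "r1 < r" "r < r2"
    and qc: "\<And>u x v. 0 < u \<Longrightarrow> u \<le> x \<Longrightarrow> x \<le> v \<Longrightarrow> min (h u) (h v) \<le> h x"
  shows "min (exp (k * r1) * R r1) (exp (k * r2) * R r2) < exp (k * r) * R r"
proof -
  define V where "V = min (exp (k * r1) * R r1) (exp (k * r2) * R r2)"
  define a where "a = V / (sqrt (2 * pi) / k)"
  have a: "a * (sqrt (2 * pi) / k) = V" using k by (simp add: a_def)
  have "V > 0" using R_pos'[of r1] R_pos'[of r2] r by (simp add: V_def)
  then have "a > 0" using k by (simp add: a_def)
  have "0 < 1 * (exp (k * r) * R r - a * (sqrt (2 * pi) / k))"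
  proof (rule tilted_sign_regular(2)[OF k r])
    show "0 < 1 * (exp ((k\<^sup>2 - k\<^sup>2) * x / 2) * h x - a)"
      if "0 < u" "u \<le> x" "x \<le> v" "0 < 1 * (exp ((k\<^sup>2 - k\<^sup>2) * u / 2) * h u - a)"
        "0 < 1 * (exp ((k\<^sup>2 - k\<^sup>2) * v / 2) * h v - a)" for u v x
      using qc[of u x v] that by auto
    show "0 \<le> 1 * (exp (k * r1) * R r1 - a * (sqrt (2 * pi) / k))"
      "0 \<le> 1 * (exp (k * r2) * R r2 - a * (sqrt (2 * pi) / k))"
      unfolding a by (auto simp: V_def)
    show "\<not> (AE x in lborel. x > 0 \<longrightarrow> 1 * (exp ((k\<^sup>2 - k\<^sup>2) * x / 2) * h x - a) = 0)"
      using not_AE_h_const[of a] \<open>a > 0\<close> by simp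
  qed
  then show ?thesis unfolding a by (simp add: V_def)
qed

text \<open>The slope of the chord of \<open>ln R\<close> is \<open>- d\<close>; it is negative
  because \<open>R\<close> decreases strictly, and \<open>d > 0\<close> is what the Gaussian
  integral requires.\<close>

lemma chord_slope:
  assumes "0 < r1" "r1 < r2"
  obtains d where "d > 0" "exp (d * r1) * R r1 = exp (d * r2) * R r2"
proof
  define d where "d = (ln (R r1) - ln (R r2)) / (r2 - r1)"
  have p: "R r1 > 0" "R r2 > 0" using R_pos' assms by auto
  show "d > 0" using R_strict_antimono[OF assms] p assms by (simp add: d_def)
  have "d * r1 + ln (R r1) = d * r2 + ln (R r2)" using assms by (simp add: d_def field_simps)
  then have "exp (d * r1 + ln (R r1)) = exp (d * r2 + ln (R r2))" by simp
  then show "exp (d * r1) * R r1 = exp (d * r2) * R r2" using p by (simp add: exp_add)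
qed

text \<open>The tilt \<open>d\<close> is chosen so that \<open>exp (d r) R(r)\<close> has the same value at both endpoints; \<open>\<sigma> = 1\<close>
  serves the log-concave and \<open>\<sigma> = -1\<close> the log-convex case.\<close>

lemma ln_R_chord:
  fixes \<sigma> :: real
  assumes r: "0 < r1" "r1 < r2" and \<theta>: "0 < \<theta>" "\<theta> < 1" and \<sigma>: "\<sigma> = 1 \<or> \<sigma> = -1"
    and conv: "\<And>d a u x v. 0 < u \<Longrightarrow> u \<le> x \<Longrightarrow> x \<le> v \<Longrightarrow> 0 < a \<Longrightarrow> 0 < \<sigma> * (exp (d * u) * h u - a)
      \<Longrightarrow> 0 < \<sigma> * (exp (d * v) * h v - a) \<Longrightarrow> 0 < \<sigma> * (exp (d * x) * h x - a)"
  shows "\<sigma> * (\<theta> * ln (R r1) + (1 - \<theta>) * ln (R r2)) \<le> \<sigma> * ln (R (\<theta> * r1 + (1 - \<theta>) * r2))"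
proof -
  obtain d where d: "d > 0" "exp (d * r1) * R r1 = exp (d * r2) * R r2"
    using chord_slope[OF r] .
  define V where "V = exp (d * r1) * R r1"
  \<comment> \<open>At this level the tilted integrals vanish at both \<open>r1\<close> and
    \<open>r2\<close>, so the endpoint conditions hold for either sign of \<sigma>.\<close>
  define a where "a = V / (sqrt (2 * pi) / d)"
  have a: "a * (sqrt (2 * pi) / d) = V" using d by (simp add: a_def)
  have p: "R r1 > 0" "R r2 > 0" using R_pos' r by auto
  then have "V > 0" by (simp add: V_def)
  then have "a > 0" using d by (simp add: a_def)
  define r0 where "r0 = \<theta> * r1 + (1 - \<theta>) * r2"
  have "r0 - r1 = (1 - \<theta>) * (r2 - r1)" "r2 - r0 = \<theta> * (r2 - r1)"
    by (simp_all add: r0_def algebra_simps)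
  then have r0: "r1 < r0" "r0 < r2" using r \<theta> by (smt (verit) mult_pos_pos)+
  then have "R r0 > 0" using R_pos' r by simp
  have V': "V = exp (d * r2) * R r2" using d by (simp add: V_def)
  have "0 \<le> \<sigma> * (exp (d * r0) * R r0 - a * (sqrt (2 * pi) / d))"
  proof (rule tilted_sign_regular(1)[OF \<open>d > 0\<close> \<open>0 < r1\<close> r0])
    show "0 < \<sigma> * (exp ((d\<^sup>2 - k\<^sup>2) * x / 2) * h x - a)"
      if "0 < u" "u \<le> x" "x \<le> v" "0 < \<sigma> * (exp ((d\<^sup>2 - k\<^sup>2) * u / 2) * h u - a)"
        "0 < \<sigma> * (exp ((d\<^sup>2 - k\<^sup>2) * v / 2) * h v - a)" for u v x
      using conv[of u x v a "(d\<^sup>2 - k\<^sup>2) / 2"] that \<open>a > 0\<close> by simp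
  qed (unfold a, simp_all add: V_def d(2))
  then have *: "\<sigma> * V \<le> \<sigma> * (exp (d * r0) * R r0)" unfolding a by (simp add: algebra_simps)
  have "\<sigma> * ln V \<le> \<sigma> * ln (exp (d * r0) * R r0)"
    using * \<open>V > 0\<close> \<open>R r0 > 0\<close> \<sigma> by auto
  also have "ln (exp (d * r0) * R r0) = d * r0 + ln (R r0)"
    using \<open>R r0 > 0\<close> by (simp add: ln_mult)
  \<comment> \<open>The \<theta>-average of the two endpoint expressions for \<open>ln V\<close>;
    its term \<open>d * r0\<close> cancels against the one at \<open>r0\<close>.\<close>
  also have "ln V = d * r0 + (\<theta> * ln (R r1) + (1 - \<theta>) * ln (R r2))"
  proof -
    have "ln V = d * r1 + ln (R r1)"
      using p by (simp add: V_def ln_mult)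
    moreover have "ln V = d * r2 + ln (R r2)"
      using p by (simp add: V' ln_mult)
    ultimately have "\<theta> * ln V + (1 - \<theta>) * ln V = \<theta> * (d * r1 + ln (R r1)) + (1 - \<theta>) * (d * r2 + ln (R r2))"
      by simp
    then show ?thesis by (simp add: r0_def algebra_simps)
  qed
  finally show ?thesis by (simp add: r0_def algebra_simps)
qed

end

section \<open>The density along the drift ray\<close>

text \<open>Decay to 0 makes the maximum attained. Strict quasiconcavity, extended to the endpoint 0
  by continuity, puts larger values immediately beside any other candidate, on the side of the
  maximiser.\<close>

lemma unique_local_max_halfline:
  fixes \<phi> :: "real \<Rightarrow> ennreal"
  assumes cont: "continuous_on {0..} \<phi>"
    and lim: "(\<lambda>n. \<phi> (real n)) \<longlonglongrightarrow> 0" and pos: "\<phi> 1 > 0"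
    and sqc: "\<And>a t b. 0 < a \<Longrightarrow> a < t \<Longrightarrow> t < b \<Longrightarrow> min (\<phi> a) (\<phi> b) < \<phi> t"
  obtains t0 where "t0 \<ge> 0" "\<And>t. t \<ge> 0 \<Longrightarrow> \<phi> t \<le> \<phi> t0"
    "\<And>t. t \<ge> 0 \<Longrightarrow> (\<forall>\<^sub>F s in at t within {0..}. \<phi> s \<le> \<phi> t) \<Longrightarrow> t = t0"
proof -
  have "\<forall>\<^sub>F n in sequentially. \<phi> (real n) < \<phi> 1 \<and> 1 < n"
    using order_tendstoD(2)[OF lim pos] eventually_gt_at_top[of 1] by eventually_elim auto
  then obtain n where n: "\<phi> (real n) < \<phi> 1" "1 < n"
    unfolding eventually_sequentially by blast
  have "continuous_on {0..real n} \<phi>" using cont by (rule continuous_on_subset) auto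
  then obtain t0 where t0: "t0 \<in> {0..real n}" "\<And>t. t \<in> {0..real n} \<Longrightarrow> \<phi> t \<le> \<phi> t0"
    using continuous_attains_sup[of "{0..real n}" \<phi>] by auto
  \<comment> \<open>Beyond \<open>n\<close> the values stay below \<open>\<phi> n\<close>: since
    \<open>\<phi> n < \<phi> 1\<close>, the minimum of \<open>\<phi> 1\<close> and
    \<open>\<phi> t\<close> can lie below \<open>\<phi> n\<close> only through
    \<open>\<phi> t\<close>.\<close>
  have max: "\<phi> t \<le> \<phi> t0" if "t \<ge> 0" for t
  proof (cases "t \<le> real n")
    case False
    then have "min (\<phi> 1) (\<phi> t) < \<phi> (real n)" using n by (intro sqc) auto
    then have "\<phi> t < \<phi> (real n)" using n by (auto simp: min_def split: if_splits)
    also have "\<dots> \<le> \<phi> t0" using t0 by simp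
    finally show ?thesis by simp
  qed (use that t0 in auto)
  \<comment> \<open>If this fails, \<phi> lies strictly below \<open>\<phi> t\<close> on the open
    interval from 0 to \<open>t\<close>, and below \<open>\<phi> (t / 2)\<close> near 0. The limit
    at 0 then gives \<open>\<phi> 0 \<le> \<phi> (t / 2) < \<phi> t \<le> \<phi> 0\<close>.\<close>
  have sqc0: "min (\<phi> 0) (\<phi> b) < \<phi> t" if tb: "0 < t" "t < b" for t b
  proof (rule ccontr)
    assume "\<not> ?thesis"
    then have c: "\<phi> t \<le> \<phi> 0" "\<phi> t \<le> \<phi> b" by (simp_all add: not_less)
    have lt: "\<phi> s < \<phi> t" if "0 < s" "s < t" for s
      using sqc[OF that \<open>t < b\<close>] c(2) by (auto simp: min_def split: if_splits)
    have "\<phi> s \<le> \<phi> (t / 2)" if "0 < s" "s < t / 2" for s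
      using sqc[of s "t / 2" t] lt[of "t / 2"] that tb by (auto simp: min_def split: if_splits)
    moreover have "\<forall>\<^sub>F s in at_right (0::real). s \<in> {0<..<t / 2}"
      using tb by (intro eventually_at_right_real) auto
    ultimately have ev: "\<forall>\<^sub>F s in at_right 0. \<phi> s \<le> \<phi> (t / 2)"
      by (auto elim!: eventually_mono)
    have "(\<phi> \<longlongrightarrow> \<phi> 0) (at 0 within {0..})" using cont by (auto simp: continuous_on_def)
    then have "(\<phi> \<longlongrightarrow> \<phi> 0) (at_right 0)" by (rule tendsto_within_subset) auto
    then have "\<phi> 0 \<le> \<phi> (t / 2)" using ev by (rule tendsto_upperbound) simp
    with lt[of "t / 2"] c tb show False by (auto simp: not_less[symmetric])
  qed
  have sqc': "min (\<phi> a) (\<phi> b) < \<phi> t" if "0 \<le> a" "a < t" "t < b" for a t b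
    using sqc[of a t b] sqc0[of t b] that by (cases "a = 0") auto
  show ?thesis
  proof (rule that[OF _ max])
    fix t assume t: "t \<ge> 0" "\<forall>\<^sub>F s in at t within {0..}. \<phi> s \<le> \<phi> t"
    then obtain \<delta> where \<delta>: "\<delta> > 0" "\<And>s. s \<ge> 0 \<Longrightarrow> s \<noteq> t \<Longrightarrow> dist s t < \<delta> \<Longrightarrow> \<phi> s \<le> \<phi> t"
      unfolding eventually_at by auto
    show "t = t0"
    proof (rule ccontr)
      assume "t \<noteq> t0"
      \<comment> \<open>A step of this length towards \<open>t0\<close> stays inside the
        neighbourhood and strictly between \<open>t\<close> and \<open>t0\<close>.\<close>
      define m where "m = min (\<delta> / 2) (\<bar>t0 - t\<bar> / 2)"
      have m: "0 < m" "m < \<delta>" "m < \<bar>t0 - t\<bar>" using \<delta>(1) \<open>t \<noteq> t0\<close> by (auto simp: m_def min_def)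
      define s where "s = (if t < t0 then t + m else t - m)"
      have s: "s \<ge> 0" "s \<noteq> t" "dist s t < \<delta>"
        using m t(1) t0(1) by (auto simp: s_def dist_real_def)
      have "min (\<phi> t) (\<phi> t0) < \<phi> s"
      proof (cases "t < t0")
        case True
        then show ?thesis using m t by (intro sqc') (auto simp: s_def)
      next
        case False
        then have "min (\<phi> t0) (\<phi> t) < \<phi> s"
          using m t t0(1) \<open>t \<noteq> t0\<close> by (intro sqc') (auto simp: s_def)
        then show ?thesis by (simp add: min.commute)
      qed
      then have "\<phi> t < \<phi> s" using max[OF t(1)] by (simp add: min_def)
      then show False using \<delta>(2)[OF s] by simp
    qed
  qed (use t0 in auto)
qed

section \<open>The ray function: decay at infinity and monotonicity\<close>

context radial_mixture
begin

definition ray :: "real \<Rightarrow> ennreal" where "ray t = ennreal (exp (k * t)) * rp t"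

lemma ray_eq: "t > 0 \<Longrightarrow> ray t = ennreal (exp (k * t) * R t)"
  using radial_part_eq_R[of t] R_pos'[of t] by (simp add: ray_def ennreal_mult)

lemma ray_continuous: "continuous_on {0..} ray"
proof -
  have "continuous_on {0..} (\<lambda>t. ennreal (exp (k * t)))"
    by (intro continuous_intros continuous_on_ennreal)
  then show ?thesis
    unfolding ray_def continuous_on_def using radial_part_continuous radial_part_pos
    by (auto intro!: tendsto_mult_ennreal simp: continuous_on_def less_imp_neq[symmetric])
qed

text \<open>Completing the square absorbs the growing factor \<open>exp (k * r)\<close>; this makes
  the bounds for large \<open>r\<close> possible.\<close>

lemma exp_radial_kernel:
  "exp (k * r) * radial_kernel k r x = indicator {0<..} x * (x powr (-1/2) * exp (- ((r - k * x)\<^sup>2 / (2 * x))))"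
proof (cases "x > 0")
  case True
  then have "- ((r - k * x)\<^sup>2 / (2 * x)) = k * r + (- (r\<^sup>2 / (2 * x)) - k\<^sup>2 * x / 2)"
    by (simp add: field_simps power2_eq_square)
  then have "exp (- ((r - k * x)\<^sup>2 / (2 * x))) = exp (k * r) * exp (- (r\<^sup>2 / (2 * x)) - k\<^sup>2 * x / 2)"
    by (simp only: exp_add)
  then show ?thesis by (simp add: radial_kernel_def)
qed (simp add: radial_kernel_def)

text \<open>Dominated convergence with a multiple of \<open>x powr q * h x\<close>. For
  \<open>x \<ge> 1\<close> the kernel is at most 1. For \<open>x < 1\<close>, taking
  \<open>n \<ge> k + 1\<close> gives \<open>n - k * x \<ge> 1\<close>, and
  \<open>powr_exp_bound\<close> controls the singularity.\<close>

lemma ray_tendsto_0: "(\<lambda>n. ray (real n)) \<longlonglongrightarrow> 0"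
proof -
  define B where "B = max 1 (exp ((q + 1/2) * ln ((q + 1/2) / (1/2)) - (q + 1/2)))"
  define N where "N = nat \<lceil>k + 1\<rceil>"
  define u where "u n x = exp (k * real n) * radial_kernel k (real n) x * h x" for n :: nat and x
  have ray_u: "ray (real n) = (\<integral>\<^sup>+x. ennreal (u n x) \<partial>lborel)" for n
    unfolding ray_def radial_part_def u_def
    by (subst nn_integral_cmult[symmetric]) (auto simp: ennreal_mult'' kernel_h_nonneg mult.assoc ennreal_mult)
  have bound: "u n x \<le> B * (indicator {0<..} x * (x powr q * h x))" if n: "n \<ge> N" for n x
  proof (cases "x > 0")
    case True
    have nk: "real n \<ge> k + 1" using n unfolding N_def by linarith
    have "x powr (-1/2) * exp (- ((real n - k * x)\<^sup>2 / (2 * x))) \<le> B * x powr q"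
    proof (cases "x \<ge> 1")
      case True
      have "x powr (-1/2) * exp (- ((real n - k * x)\<^sup>2 / (2 * x))) \<le> x powr 0 * 1"
        using True by (intro mult_mono powr_mono) auto
      also have "\<dots> \<le> B * x powr q"
        using True q by (intro mult_mono) (auto simp: B_def ge_one_powr_ge_zero)
      finally show ?thesis .
    next
      case False
      have "k * x \<le> k * 1" using False k by (intro mult_left_mono) auto
      then have "1 \<le> real n - k * x" using nk by simp
      then have "1 \<le> (real n - k * x)\<^sup>2" by simp
      then have "exp (- ((real n - k * x)\<^sup>2 / (2 * x))) \<le> exp (- (1/2 * (1 / x)))"
        using \<open>x > 0\<close> by (simp add: field_simps)
      then have "x powr (-1/2) * exp (- ((real n - k * x)\<^sup>2 / (2 * x))) \<le> x powr (-1/2) * exp (- (1/2 * (1 / x)))"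
        by (intro mult_left_mono) auto
      also have "\<dots> = ((1 / x) powr (q + 1/2) * exp (- (1/2 * (1 / x)))) * x powr q"
        using \<open>x > 0\<close> by (simp add: powr_divide powr_add powr_minus_divide)
      also have "\<dots> \<le> B * x powr q"
        unfolding B_def using powr_exp_bound[of "1/2" "q + 1/2" "1 / x"] q \<open>x > 0\<close>
        by (intro mult_right_mono) auto
      finally show ?thesis .
    qed
    from mult_right_mono[OF this h_nonneg[OF True]] show ?thesis
      unfolding u_def exp_radial_kernel using True by (simp add: mult.assoc)
  qed (simp add: u_def radial_kernel_def)
  have u0: "(\<lambda>n. u n x) \<longlonglongrightarrow> 0" for x
  proof (cases "x > 0")
    case True
    have "(\<lambda>n. exp (- ((real n - k * x)\<^sup>2 / (2 * x)))) \<longlonglongrightarrow> 0" using True by real_asymp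
    then have "(\<lambda>n. x powr (-1/2) * exp (- ((real n - k * x)\<^sup>2 / (2 * x))) * h x) \<longlonglongrightarrow> x powr (-1/2) * 0 * h x"
      by (intro tendsto_intros)
    then show ?thesis unfolding u_def exp_radial_kernel using True by simp
  qed (simp add: u_def radial_kernel_def)
  have "(\<lambda>n. \<integral>\<^sup>+x. ennreal (u (n + N) x) \<partial>lborel) \<longlonglongrightarrow> (\<integral>\<^sup>+(x::real). 0 \<partial>lborel)"
  proof (rule nn_integral_dominated_convergence[where w = "\<lambda>x::real. ennreal (B * (indicator {0<..} x * (x powr q * h x)))"])
    show "(\<integral>\<^sup>+x. ennreal (B * (indicator {0<..} x * (x powr q * h x))) \<partial>lborel) < \<infinity>"
      using h_nonneg by (subst nn_integral_eq_integral) (auto intro!: h_int AE_I2 simp: B_def split: split_indicator)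
    show "(\<lambda>x. ennreal (u (n + N) x)) \<in> borel_measurable lborel" for n
      unfolding u_def mult.assoc by measurable
    show "(\<lambda>x. ennreal (B * (indicator {0<..} x * (x powr q * h x)))) \<in> borel_measurable lborel"
      using borel_measurable_integrable[OF h_int] by measurable
    show "AE x in lborel. (\<lambda>n. ennreal (u (n + N) x)) \<longlonglongrightarrow> 0"
      using LIMSEQ_ignore_initial_segment[OF u0] by (auto intro!: AE_I2 tendsto_ennrealI[of _ 0, simplified])
  qed (use bound in \<open>auto intro!: AE_I2 ennreal_leI\<close>)
  then have "(\<lambda>n. ray (real (n + N))) \<longlonglongrightarrow> 0" unfolding ray_u by simp
  then show ?thesis by (rule LIMSEQ_offset)
qed

lemma ray_unique_local_max:
  assumes k: "k > 0" and qc: "\<And>u x v. 0 < u \<Longrightarrow> u \<le> x \<Longrightarrow> x \<le> v \<Longrightarrow> min (h u) (h v) \<le> h x"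
  obtains t0 where "t0 \<ge> 0" "\<And>t. t \<ge> 0 \<Longrightarrow> ray t \<le> ray t0"
    "\<And>t. t \<ge> 0 \<Longrightarrow> (\<forall>\<^sub>F s in at t within {0..}. ray s \<le> ray t) \<Longrightarrow> t = t0"
proof (rule unique_local_max_halfline[OF ray_continuous ray_tendsto_0])
  show "ray 1 > 0" using ray_eq[of 1] R_pos'[of 1] by (simp add: ennreal_less_zero_iff)
  show "min (ray a) (ray b) < ray t" if "0 < a" "a < t" "t < b" for a t b
    using ray_density_strictly_quasiconcave[OF k that qc] R_pos'[of a] R_pos'[of b] that
    by (auto simp: ray_eq ennreal_less_iff min_def split: if_splits)
qed (use that in blast)

text \<open>For decreasing \<open>h\<close> the function \<psi> changes sign at most once, from plus
  to minus, and the kernel \<open>exp (- s / x)\<close> then forbids its integral to pass from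
  negative to positive as \<open>s\<close> grows. A level \<open>V\<close> between the two values
  would give such a passage.\<close>

lemma ray_density_antimono:
  assumes k: "k > 0" and anti: "antimono_on {0<..} h" and r: "0 < r" "r < r'"
  shows "exp (k * r') * R r' \<le> exp (k * r) * R r"
proof (rule ccontr)
  assume "\<not> ?thesis"
  then have lt: "exp (k * r) * R r < exp (k * r') * R r'" by simp
  define V where "V = (exp (k * r) * R r + exp (k * r') * R r') / 2"
  define a where "a = V / (sqrt (2 * pi) / k)"
  have a: "a * (sqrt (2 * pi) / k) = V" using k by (simp add: a_def)
  define \<psi> where "\<psi> = (\<lambda>x. radial_kernel k 0 x * (1 * (exp ((k\<^sup>2 - k\<^sup>2) * x / 2) * h x - a)))"
  have \<psi>: "\<psi> x = radial_kernel k 0 x * (h x - a)" for x by (simp add: \<psi>_def)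
  have t: "integrable lborel (\<lambda>x. exp (- (\<rho>\<^sup>2 / 2 / x)) * \<psi> x)"
      "(LINT x|lborel. exp (- (\<rho>\<^sup>2 / 2 / x)) * \<psi> x) = exp (- (k * \<rho>)) * (exp (k * \<rho>) * R \<rho> - V)"
    if "\<rho> > 0" for \<rho>
    unfolding \<psi>_def using tilted_integral[OF k that, of 1 a, unfolded a] by simp_all
  have neg: "(LINT x|lborel. exp (- (r\<^sup>2 / 2 / x)) * \<psi> x) < 0"
    using lt r by (subst t(2)) (auto simp: V_def mult_less_0_iff field_simps)
  have pos: "(LINT x|lborel. exp (- (r'\<^sup>2 / 2 / x)) * \<psi> x) > 0"
    using lt r by (subst t(2)) (auto simp: V_def zero_less_mult_iff field_simps)
  define J where "J = {x. 0 < x \<and> a < h x}"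
  have down: "x \<in> J" if "0 < x" "x \<le> y" "y \<in> J" for x y
    using monotone_onD[OF anti, of x y] that by (auto simp: J_def)
  have sgn: "x \<in> J \<Longrightarrow> 0 \<le> \<psi> x" "x \<notin> J \<Longrightarrow> \<psi> x \<le> 0" for x
    using radial_kernel_nonneg[of k 0 x] radial_kernel_eq_0[of x k 0]
    by (cases "x > 0"; auto simp: \<psi> J_def intro: mult_nonneg_nonpos)+
  have "J \<noteq> {}"
  proof
    assume "J = {}"
    then have "0 \<le> (LINT x|lborel. - (exp (- (r'\<^sup>2 / 2 / x)) * \<psi> x))"
      using sgn by (intro integral_nonneg_AE AE_I2) (auto intro!: mult_nonneg_nonpos)
    with pos show False by simp
  qed
  show False
  proof (cases "bdd_above J")
    case False
    have "0 \<le> \<psi> x" for x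
    proof (cases "x > 0")
      case True
      obtain y where "y \<in> J" "x \<le> y" using False by (meson bdd_above.I le_cases)
      then show ?thesis using down[OF True] sgn(1) by blast
    qed (simp add: \<psi> radial_kernel_eq_0)
    then have "0 \<le> (LINT x|lborel. exp (- (r\<^sup>2 / 2 / x)) * \<psi> x)"
      by (intro integral_nonneg_AE AE_I2 mult_nonneg_nonneg) auto
    with neg show False by simp
  next
    case True
    define x0 where "x0 = Sup J"
    obtain y where "y \<in> J" using \<open>J \<noteq> {}\<close> by blast
    then have "x0 > 0" using cSup_upper[OF _ True, of y] by (auto simp: x0_def J_def)
    have in': "x \<in> J" if x: "0 < x" "x < x0" for x
    proof -
      obtain y where "y \<in> J" "x < y"
        using less_cSup_iff[OF \<open>J \<noteq> {}\<close> True, of x] x unfolding x0_def by blast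
      then show ?thesis using down[of x y] x by simp
    qed
    have out: "x \<notin> J" if "x > x0" for x
      using cSup_upper[OF _ True, of x] that unfolding x0_def by force
    define s where "s = r\<^sup>2 / 2"
    define s' where "s' = r'\<^sup>2 / 2"
    have "s < s'" using r by (simp add: s_def s'_def power_strict_mono)
    \<comment> \<open>With this factor \<open>exp (- (s / x)) - \<alpha> * exp (- (s' / x))\<close>
      changes sign at \<open>x0\<close>, exactly where \<psi> does, so its product with \<psi> is
      nonnegative.\<close>
    define \<alpha> where "\<alpha> = exp ((s' - s) / x0)"
    have nn: "0 \<le> exp (- (s / x)) * \<psi> x - \<alpha> * (exp (- (s' / x)) * \<psi> x)" for x
    proof -
      have eq: "exp (- (s / x)) * \<psi> x - \<alpha> * (exp (- (s' / x)) * \<psi> x)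
          = exp (- (s' / x)) * ((exp ((s' - s) / x) - \<alpha>) * \<psi> x)"
        by (simp add: algebra_simps diff_divide_distrib flip: exp_add)
      consider "x \<le> 0" | "0 < x" "x < x0" | "x = x0" | "x > x0" by linarith
      then have "0 \<le> (exp ((s' - s) / x) - \<alpha>) * \<psi> x"
      proof cases
        case 2
        have "(s' - s) / x0 \<le> (s' - s) / x" using 2 \<open>s < s'\<close> by (intro divide_left_mono) auto
        then show ?thesis using sgn(1)[OF in'[OF 2]] by (simp add: \<alpha>_def)
      next
        case 4
        have "(s' - s) / x \<le> (s' - s) / x0" using 4 \<open>s < s'\<close> \<open>x0 > 0\<close> by (intro divide_left_mono) auto
        then show ?thesis using sgn(2)[OF out[OF 4]] by (simp add: \<alpha>_def mult_nonpos_nonpos)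
      qed (auto simp: \<alpha>_def \<psi> radial_kernel_eq_0)
      then show ?thesis unfolding eq by simp
    qed
    have "0 \<le> (LINT x|lborel. exp (- (s / x)) * \<psi> x - \<alpha> * (exp (- (s' / x)) * \<psi> x))"
      by (intro integral_nonneg_AE AE_I2 nn)
    also have "\<dots> = (LINT x|lborel. exp (- (s / x)) * \<psi> x) - \<alpha> * (LINT x|lborel. exp (- (s' / x)) * \<psi> x)"
      using t(1)[of r] t(1)[of r'] r unfolding s_def s'_def
      by (subst Bochner_Integration.integral_diff) auto
    finally have "\<alpha> * (LINT x|lborel. exp (- (s' / x)) * \<psi> x) \<le> (LINT x|lborel. exp (- (s / x)) * \<psi> x)" by simp
    moreover have "0 < \<alpha> * (LINT x|lborel. exp (- (s' / x)) * \<psi> x)" using pos by (simp add: \<alpha>_def s'_def)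
    ultimately show False using neg unfolding s_def by simp
  qed
qed

text \<open>Monotonicity is available at positive radii only; continuity carries it to 0, including
  the case of an infinite value there.\<close>

lemma ray_le_ray_0:
  assumes "k > 0" "antimono_on {0<..} h" "t \<ge> 0"
  shows "ray t \<le> ray 0"
proof (cases "t = 0")
  case False
  then have "t > 0" using assms by simp
  then have "\<forall>\<^sub>F s in at_right (0::real). s \<in> {0<..<t}" by (intro eventually_at_right_real)
  then have ev: "\<forall>\<^sub>F s in at_right 0. ray t \<le> ray s"
  proof (rule eventually_mono)
    fix s assume "s \<in> {0<..<t}"
    then show "ray t \<le> ray s"
      using ray_density_antimono[OF assms(1,2), of s t] by (auto simp: ray_eq intro!: ennreal_leI)
  qed
  have "(ray \<longlongrightarrow> ray 0) (at 0 within {0..})" using ray_continuous by (auto simp: continuous_on_def)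
  then have "(ray \<longlongrightarrow> ray 0) (at_right 0)" by (rule tendsto_within_subset) auto
  then show ?thesis using ev by (rule tendsto_lowerbound) simp
qed simp

end

section \<open>Log-concavity and the multivariate density\<close>

context radial_mixture
begin

text \<open>Exponential tilts preserve log-concavity, so the superlevel sets of
  \<open>exp (d * x) * h x\<close> are intervals and \<open>ln_R_chord\<close> applies with \<sigma>
  = 1.\<close>

lemma ln_R_concave:
  assumes lc: "log_concave_on {0<..} h" and r: "r1 > 0" "r2 > 0" and \<theta>: "0 < \<theta>" "\<theta> < 1"
  shows "\<theta> * ln (R r1) + (1 - \<theta>) * ln (R r2) \<le> ln (R (\<theta> * r1 + (1 - \<theta>) * r2))"
proof -
  have conv: "0 < 1 * (exp (d * x) * h x - a)"
    if u: "0 < u" and ux: "u \<le> x" "x \<le> v" and a: "0 < a"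
      and hu: "0 < 1 * (exp (d * u) * h u - a)" and hv: "0 < 1 * (exp (d * v) * h v - a)"
    for d a u x v :: real
  proof -
    consider "x = u" | "x = v" | "u < x" "x < v" using ux by linarith
    then show ?thesis
    proof cases
      case 3
      define \<theta> where "\<theta> = (v - x) / (v - u)"
      have \<theta>: "0 < \<theta>" "\<theta> < 1" using 3 by (simp_all add: \<theta>_def)
      have "\<theta> * (v - u) = v - x" using 3 by (simp add: \<theta>_def)
      then have x: "x = \<theta> * u + (1 - \<theta>) * v" by (simp add: algebra_simps)
      \<comment> \<open>Since \<open>a > 0\<close>, the zeros of \<open>h\<close> lie outside the
        superlevel set and logarithms may be taken.\<close>
      have "0 < exp (d * u) * h u" "0 < exp (d * v) * h v" using hu hv a by simp_all
      then have p: "h u > 0" "h v > 0" by (simp_all add: zero_less_mult_iff)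
      have "h u powr \<theta> * h v powr (1 - \<theta>) \<le> h x"
        using lc u 3 \<theta> unfolding log_concave_on_def x by auto
      then have hx: "exp (\<theta> * ln (h u) + (1 - \<theta>) * ln (h v)) \<le> h x"
        using p by (simp add: powr_def exp_add)
      have "ln a < ln (exp (d * u) * h u)" "ln a < ln (exp (d * v) * h v)"
        using a hu hv by (simp_all add: ln_less_cancel_iff)
      then have "ln a < d * u + ln (h u)" "ln a < d * v + ln (h v)" using p by (simp_all add: ln_mult)
      then have "\<theta> * ln a + (1 - \<theta>) * ln a < \<theta> * (d * u + ln (h u)) + (1 - \<theta>) * (d * v + ln (h v))"
        using \<theta> by (intro add_strict_mono mult_strict_left_mono) auto
      then have "ln a < d * x + (\<theta> * ln (h u) + (1 - \<theta>) * ln (h v))"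
        unfolding x by (simp add: algebra_simps)
      then have "exp (ln a) < exp (d * x) * exp (\<theta> * ln (h u) + (1 - \<theta>) * ln (h v))"
        unfolding exp_add[symmetric] by simp
      also have "\<dots> \<le> exp (d * x) * h x" using hx by simp
      finally show ?thesis using a by simp
    qed (use hu hv in auto)
  qed
  have chord: "\<theta> * ln (R r1) + (1 - \<theta>) * ln (R r2) \<le> ln (R (\<theta> * r1 + (1 - \<theta>) * r2))"
    if "0 < r1" "r1 < r2" "0 < \<theta>" "\<theta> < 1" for r1 r2 \<theta>
  proof -
    have "1 * (\<theta> * ln (R r1) + (1 - \<theta>) * ln (R r2)) \<le> 1 * ln (R (\<theta> * r1 + (1 - \<theta>) * r2))"
      by (rule ln_R_chord[OF that], simp, erule (5) conv)
    then show ?thesis by simp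
  qed
  consider "r1 < r2" | "r1 = r2" | "r2 < r1" by linarith
  then show ?thesis
  proof cases
    case 1 then show ?thesis using chord[of r1 r2 \<theta>] r \<theta> by simp
  next
    case 2 then show ?thesis by (simp add: algebra_simps)
  next
    case 3 then show ?thesis using chord[of r2 r1 "1 - \<theta>"] r \<theta> by (simp add: add.commute)
  qed
qed

text \<open>Dually, strict sublevel sets of a tilted log-convex function are intervals, which is the
  hypothesis of \<open>ln_R_chord\<close> for \<sigma> = -1.\<close>

lemma ln_R_convex:
  assumes lc: "log_convex_on {0<..} h" and r: "r1 > 0" "r2 > 0" and \<theta>: "0 < \<theta>" "\<theta> < 1"
  shows "ln (R (\<theta> * r1 + (1 - \<theta>) * r2)) \<le> \<theta> * ln (R r1) + (1 - \<theta>) * ln (R r2)"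
proof -
  have hp: "h x > 0" if "x > 0" for x using lc that by (simp add: log_convex_on_def)
  have conv: "0 < (-1) * (exp (d * x) * h x - a)"
    if u: "0 < u" and ux: "u \<le> x" "x \<le> v" and a: "0 < a"
      and hu: "0 < (-1) * (exp (d * u) * h u - a)" and hv: "0 < (-1) * (exp (d * v) * h v - a)"
    for d a u x v :: real
  proof -
    consider "x = u" | "x = v" | "u < x" "x < v" using ux by linarith
    then show ?thesis
    proof cases
      case 3
      define \<theta> where "\<theta> = (v - x) / (v - u)"
      have \<theta>: "0 < \<theta>" "\<theta> < 1" using 3 by (simp_all add: \<theta>_def)
      have "\<theta> * (v - u) = v - x" using 3 by (simp add: \<theta>_def)
      then have x: "x = \<theta> * u + (1 - \<theta>) * v" by (simp add: algebra_simps)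
      have p: "h u > 0" "h v > 0" "h x > 0" using hp u ux by auto
      have hx: "ln (h x) \<le> \<theta> * ln (h u) + (1 - \<theta>) * ln (h v)"
        using lc u 3 \<theta> convex_onD[of "{0<..}" "\<lambda>x. ln (h x)" "1 - \<theta>" u v]
        unfolding log_convex_on_def x by auto
      have "ln (exp (d * u) * h u) < ln a" "ln (exp (d * v) * h v) < ln a"
        using a hu hv p by (simp_all add: ln_less_cancel_iff)
      then have "d * u + ln (h u) < ln a" "d * v + ln (h v) < ln a" using p by (simp_all add: ln_mult)
      then have "\<theta> * (d * u + ln (h u)) + (1 - \<theta>) * (d * v + ln (h v)) < \<theta> * ln a + (1 - \<theta>) * ln a"
        using \<theta> by (intro add_strict_mono mult_strict_left_mono) auto
      then have "d * x + (\<theta> * ln (h u) + (1 - \<theta>) * ln (h v)) < ln a"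
        unfolding x by (simp add: algebra_simps)
      then have "d * x + ln (h x) < ln a" using hx by simp
      then have "ln (exp (d * x) * h x) < ln a" using p by (simp add: ln_mult)
      then show ?thesis using a p by (simp add: ln_less_cancel_iff)
    qed (use hu hv in auto)
  qed
  have chord: "ln (R (\<theta> * r1 + (1 - \<theta>) * r2)) \<le> \<theta> * ln (R r1) + (1 - \<theta>) * ln (R r2)"
    if "0 < r1" "r1 < r2" "0 < \<theta>" "\<theta> < 1" for r1 r2 \<theta>
  proof -
    have "(-1) * (\<theta> * ln (R r1) + (1 - \<theta>) * ln (R r2)) \<le> (-1) * ln (R (\<theta> * r1 + (1 - \<theta>) * r2))"
      by (rule ln_R_chord[OF that], simp, erule (5) conv)
    then show ?thesis by simp
  qed
  consider "r1 < r2" | "r1 = r2" | "r2 < r1" by linarith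
  then show ?thesis
  proof cases
    case 1 then show ?thesis using chord[of r1 r2 \<theta>] r \<theta> by simp
  next
    case 2 then show ?thesis by (simp add: algebra_simps)
  next
    case 3 then show ?thesis using chord[of r2 r1 "1 - \<theta>"] r \<theta> by (simp add: add.commute)
  qed
qed

section \<open>Log-concave mixing functions: finiteness and log-concavity up to radius zero\<close>

lemma radial_part_tendsto_at_right:
  assumes "r \<ge> 0"
  shows "((\<lambda>\<epsilon>. rp (r + \<epsilon>)) \<longlongrightarrow> rp r) (at_right 0)"
proof (rule continuous_on_tendsto_compose[OF radial_part_continuous])
  show "((\<lambda>\<epsilon>. r + \<epsilon>) \<longlongrightarrow> r) (at_right 0)" by (auto intro!: tendsto_eq_intros)
  show "\<forall>\<^sub>F \<epsilon> in at_right 0. r + \<epsilon> \<in> {0..}"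
    using assms by (auto intro: eventually_mono[OF eventually_at_right_less])
qed (use assms in auto)

lemma log_concave_integrable_0:
  assumes lc: "log_concave_on {0<..} h"
  shows "integrable lborel (\<lambda>x. radial_kernel k 0 x * h x)"
proof -
  define B where "B = exp (2 * ln (R 1) + \<bar>ln (R 2)\<bar> + 2 * \<bar>ln (R 1)\<bar>)"
  have "R \<epsilon> \<le> B" if e: "0 < \<epsilon>" "\<epsilon> < 1" for \<epsilon>
  proof -
    \<comment> \<open>The weight that places 1 between \<epsilon> and 2. Concavity of
      \<open>ln R\<close> then bounds \<open>ln (R \<epsilon>)\<close> uniformly as \<epsilon> tends
      to 0, so the monotone limit \<open>rp 0\<close> is finite.\<close>
    define \<theta> where "\<theta> = 1 / (2 - \<epsilon>)"
    have \<theta>: "1 / 2 < \<theta>" "\<theta> < 1" "\<theta> * (2 - \<epsilon>) = 1" using e by (simp_all add: \<theta>_def field_simps)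
    have eq: "\<theta> * \<epsilon> + (1 - \<theta>) * 2 = 1" using \<theta>(3) by (simp add: algebra_simps)
    have "\<theta> * ln (R \<epsilon>) + (1 - \<theta>) * ln (R 2) \<le> ln (R 1)"
      using ln_R_concave[OF lc, of \<epsilon> 2 \<theta>, unfolded eq] \<theta> e by simp
    moreover have "- \<bar>ln (R 2)\<bar> / 2 \<le> (1 - \<theta>) * ln (R 2)"
    proof -
      have "\<bar>(1 - \<theta>) * ln (R 2)\<bar> \<le> 1 / 2 * \<bar>ln (R 2)\<bar>"
        unfolding abs_mult using \<theta> by (intro mult_right_mono) auto
      then show ?thesis by linarith
    qed
    ultimately have le: "\<theta> * ln (R \<epsilon>) \<le> ln (R 1) + \<bar>ln (R 2)\<bar> / 2" by linarith
    have "ln (R \<epsilon>) \<le> 2 * ln (R 1) + \<bar>ln (R 2)\<bar> + 2 * \<bar>ln (R 1)\<bar>"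
    proof (cases "ln (R \<epsilon>) \<ge> 0")
      case True
      then have "1 / 2 * ln (R \<epsilon>) \<le> \<theta> * ln (R \<epsilon>)" using \<theta> by (intro mult_right_mono) auto
      then show ?thesis using le by linarith
    qed linarith
    then show ?thesis unfolding B_def using R_pos'[OF e(1)] by (metis exp_le_cancel_iff exp_ln)
  qed
  then have "\<forall>\<^sub>F \<epsilon> in at_right 0. rp (0 + \<epsilon>) \<le> ennreal B"
    by (intro eventually_mono[OF eventually_at_right_real[of 0 1]])
       (auto simp: radial_part_eq_R intro!: ennreal_leI)
  then have "rp 0 \<le> ennreal B"
    by (rule tendsto_upperbound[OF radial_part_tendsto_at_right[of 0, OF order_refl]]) simp
  then show ?thesis unfolding integrable_iff_finite by (rule le_less_trans) simp
qed

lemma R_log_concave: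
  assumes lc: "log_concave_on {0<..} h" and r: "r1 \<ge> 0" "r2 \<ge> 0" and \<theta>: "0 < \<theta>" "\<theta> < 1"
  shows "R r1 powr \<theta> * R r2 powr (1 - \<theta>) \<le> R (\<theta> * r1 + (1 - \<theta>) * r2)"
proof -
  have int: "integrable lborel (\<lambda>x. radial_kernel k r x * h x)" if "r \<ge> 0" for r
    using log_concave_integrable_0[OF lc] integrable_radial[of r] that by (cases "r = 0") auto
  have R_enn: "R r = enn2real (rp r)" "R r > 0" if "r \<ge> 0" for r
    using radial_part_eq[OF int[OF that]] R_pos[OF int[OF that]] by auto
  have lim: "((\<lambda>\<epsilon>. R (r + \<epsilon>)) \<longlongrightarrow> R r) (at_right 0)" if "r \<ge> 0" for r
  proof -
    have "((\<lambda>\<epsilon>. enn2real (rp (r + \<epsilon>))) \<longlongrightarrow> R r) (at_right 0)"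
      using radial_part_tendsto_at_right[OF that] R_enn(2)[OF that] unfolding radial_part_eq[OF int[OF that]]
      by (intro tendsto_enn2real) auto
    moreover have "\<forall>\<^sub>F \<epsilon> in at_right 0. enn2real (rp (r + \<epsilon>)) = R (r + \<epsilon>)"
      using that by (auto intro!: eventually_mono[OF eventually_at_right_less] simp: R_enn)
    ultimately show ?thesis by (rule Lim_transform_eventually)
  qed
  define r0 where "r0 = \<theta> * r1 + (1 - \<theta>) * r2"
  have "r0 \<ge> 0" using r \<theta> by (simp add: r0_def)
  \<comment> \<open>Shifting both radii by \<epsilon> shifts their convex combination by \<epsilon>
    and makes all of them positive; letting \<epsilon> tend to 0 admits radius 0.\<close>
  have ineq: "R (r1 + \<epsilon>) powr \<theta> * R (r2 + \<epsilon>) powr (1 - \<theta>) \<le> R (r0 + \<epsilon>)" if "\<epsilon> > 0" for \<epsilon>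
  proof -
    have p: "R (r1 + \<epsilon>) > 0" "R (r2 + \<epsilon>) > 0" "R (r0 + \<epsilon>) > 0" using that r \<open>r0 \<ge> 0\<close> by (auto intro!: R_pos')
    have "\<theta> * (r1 + \<epsilon>) + (1 - \<theta>) * (r2 + \<epsilon>) = r0 + \<epsilon>" by (simp add: r0_def algebra_simps)
    then have "\<theta> * ln (R (r1 + \<epsilon>)) + (1 - \<theta>) * ln (R (r2 + \<epsilon>)) \<le> ln (R (r0 + \<epsilon>))"
      using ln_R_concave[OF lc, of "r1 + \<epsilon>" "r2 + \<epsilon>" \<theta>] that r \<theta> by simp
    then have "exp (\<theta> * ln (R (r1 + \<epsilon>)) + (1 - \<theta>) * ln (R (r2 + \<epsilon>))) \<le> exp (ln (R (r0 + \<epsilon>)))"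
      by simp
    then show ?thesis using p by (simp add: powr_def exp_add)
  qed
  show ?thesis
  proof (rule tendsto_le)
    show "((\<lambda>\<epsilon>. R (r1 + \<epsilon>) powr \<theta> * R (r2 + \<epsilon>) powr (1 - \<theta>)) \<longlongrightarrow> R r1 powr \<theta> * R r2 powr (1 - \<theta>)) (at_right 0)"
      using R_enn(2)[OF r(1)] R_enn(2)[OF r(2)] by (intro tendsto_intros lim r) auto
    show "((\<lambda>\<epsilon>. R (r0 + \<epsilon>)) \<longlongrightarrow> R (\<theta> * r1 + (1 - \<theta>) * r2)) (at_right 0)"
      using lim[OF \<open>r0 \<ge> 0\<close>] unfolding r0_def .
    show "\<forall>\<^sub>F \<epsilon> in at_right 0. R (r1 + \<epsilon>) powr \<theta> * R (r2 + \<epsilon>) powr (1 - \<theta>) \<le> R (r0 + \<epsilon>)"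
      using ineq by (auto intro!: eventually_mono[OF eventually_at_right_less])
  qed simp
qed

end

section \<open>Local maxima of an exponential drift times a decreasing radial function\<close>

definition drifted :: "(real \<Rightarrow> ennreal) \<Rightarrow> 'a::euclidean_space \<Rightarrow> 'a \<Rightarrow> ennreal" where
  "drifted \<rho> c w = ennreal (exp (w \<bullet> c)) * \<rho> (norm w)"

lemma ennreal_mult_strict_mono:
  fixes a b c d :: ennreal
  assumes "a \<le> b" "c < d" "0 < a" "b < \<infinity>"
  shows "a * c < b * d"
proof -
  have "a * c < a * d" using assms by (intro ennreal_mult_strict_left_mono) auto
  also have "\<dots> \<le> b * d" using assms by (intro mult_right_mono) auto
  finally show ?thesis .
qed

text \<open>Along \<open>z\<close> the exponential factor does not drop while the radial factor
  strictly rises; the exponential is positive and finite, so the product rises strictly.\<close>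

lemma drifted_not_local_max:
  fixes c w z :: "'a::euclidean_space"
  assumes anti: "\<And>r r'. 0 \<le> r \<Longrightarrow> r < r' \<Longrightarrow> \<rho> r' < \<rho> r"
    and z: "z \<bullet> c \<ge> 0" and \<delta>: "\<delta> > 0" "\<And>\<epsilon>. 0 < \<epsilon> \<Longrightarrow> \<epsilon> < \<delta> \<Longrightarrow> norm (w + \<epsilon> *\<^sub>R z) < norm w"
  shows "\<not> local_max (drifted \<rho> c) w"
proof
  assume "local_max (drifted \<rho> c) w"
  then have ev: "\<forall>\<^sub>F y in nhds w. drifted \<rho> c y \<le> drifted \<rho> c w" by (simp add: local_max_def)
  have "((\<lambda>\<epsilon>. w + \<epsilon> *\<^sub>R z) \<longlongrightarrow> w) (at_right 0)" by (auto intro!: tendsto_eq_intros)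
  from filterlim_iff[THEN iffD1, OF this] ev
  have "\<forall>\<^sub>F \<epsilon> in at_right 0. drifted \<rho> c (w + \<epsilon> *\<^sub>R z) \<le> drifted \<rho> c w" by blast
  moreover have "\<forall>\<^sub>F \<epsilon> in at_right (0::real). \<epsilon> \<in> {0<..<\<delta>}"
    using \<delta>(1) by (rule eventually_at_right_real)
  ultimately have "\<forall>\<^sub>F \<epsilon> in at_right (0::real). drifted \<rho> c (w + \<epsilon> *\<^sub>R z) \<le> drifted \<rho> c w \<and> \<epsilon> \<in> {0<..<\<delta>}"
    by eventually_elim simp
  then obtain \<epsilon> where e: "drifted \<rho> c (w + \<epsilon> *\<^sub>R z) \<le> drifted \<rho> c w" "0 < \<epsilon>" "\<epsilon> < \<delta>"
    using eventually_happens' [OF trivial_limit_at_right_real] by fastforce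
  have "drifted \<rho> c w < drifted \<rho> c (w + \<epsilon> *\<^sub>R z)"
    unfolding drifted_def
  proof (rule ennreal_mult_strict_mono)
    show "ennreal (exp (w \<bullet> c)) \<le> ennreal (exp ((w + \<epsilon> *\<^sub>R z) \<bullet> c))"
      using z e by (intro ennreal_leI) (simp add: inner_add_left)
    show "\<rho> (norm w) < \<rho> (norm (w + \<epsilon> *\<^sub>R z))" by (rule anti) (use \<delta>(2)[OF e(2,3)] in auto)
  qed auto
  with e show False by simp
qed

lemma local_max_drifted_0:
  fixes w :: "'a::euclidean_space"
  assumes anti: "\<And>r r'. 0 \<le> r \<Longrightarrow> r < r' \<Longrightarrow> \<rho> r' < \<rho> r"
  shows "local_max (drifted \<rho> 0) w \<longleftrightarrow> w = 0"
proof
  assume lm: "local_max (drifted \<rho> 0) w"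
  show "w = 0"
  proof (rule ccontr)
    assume "w \<noteq> 0"
    have "norm (w + \<epsilon> *\<^sub>R (- w)) < norm w" if "0 < \<epsilon>" "\<epsilon> < 1" for \<epsilon>
    proof -
      have "w + \<epsilon> *\<^sub>R (- w) = (1 - \<epsilon>) *\<^sub>R w" by (simp add: algebra_simps)
      then have "norm (w + \<epsilon> *\<^sub>R (- w)) = (1 - \<epsilon>) * norm w" using that by simp
      then show ?thesis using that \<open>w \<noteq> 0\<close> by simp
    qed
    then have "\<not> local_max (drifted \<rho> 0) w"
      using drifted_not_local_max[of \<rho> "- w" 0 1 w, OF anti] by simp
    with lm show False by contradiction
  qed
next
  assume "w = 0"
  have "\<rho> (norm y) \<le> \<rho> 0" for y :: 'a using anti[of 0 "norm y"] by (cases "y = 0") (auto intro: less_imp_le)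
  then show "local_max (drifted \<rho> 0) w" using \<open>w = 0\<close> by (simp add: local_max_def drifted_def)
qed

text \<open>Off the ray spanned by \<open>c\<close>, moving along \<open>sgn c - sgn w\<close> shortens \<open>w\<close> and increases \<open>w \<bullet> c\<close>.\<close>

lemma local_max_drifted_on_ray:
  fixes c w :: "'a::euclidean_space"
  assumes anti: "\<And>r r'. 0 \<le> r \<Longrightarrow> r < r' \<Longrightarrow> \<rho> r' < \<rho> r"
    and c: "c \<noteq> 0" and lm: "local_max (drifted \<rho> c) w"
  shows "w = norm w *\<^sub>R sgn c"
proof (rule ccontr)
  assume ne: "w \<noteq> norm w *\<^sub>R sgn c"
  then have "w \<noteq> 0" by auto
  define z where "z = sgn c - sgn w"
  have "z \<noteq> 0"
  proof
    assume "z = 0"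
    then have "norm w *\<^sub>R sgn c = norm w *\<^sub>R sgn w" by (simp add: z_def)
    then show False using ne \<open>w \<noteq> 0\<close> by (simp add: sgn_div_norm)
  qed
  define s where "s = sgn c \<bullet> sgn w"
  have n: "norm (sgn c) = 1" "norm (sgn w) = 1" using c \<open>w \<noteq> 0\<close> by (simp_all add: norm_sgn)
  have cw: "c = norm c *\<^sub>R sgn c" "w = norm w *\<^sub>R sgn w" using c \<open>w \<noteq> 0\<close> by (simp_all add: sgn_div_norm)
  have ss: "sgn c \<bullet> sgn c = 1" "sgn w \<bullet> sgn w = 1" using n by (simp_all add: dot_square_norm)
  have zz: "z \<bullet> z = 2 * (1 - s)"
    unfolding z_def s_def by (simp add: inner_diff_left inner_diff_right ss inner_commute)
  then have s1: "s < 1" using \<open>z \<noteq> 0\<close> inner_gt_zero_iff[of z] by simp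
  have zc: "z \<bullet> c = norm c * (1 - s)"
  proof -
    have "z \<bullet> c = norm c * (z \<bullet> sgn c)" using cw(1) by (metis inner_scaleR_right)
    then show ?thesis by (simp add: z_def s_def inner_diff_left inner_diff_right ss inner_commute)
  qed
  have wz: "w \<bullet> z = - norm w * (1 - s)"
  proof -
    have "w \<bullet> z = norm w * (sgn w \<bullet> z)" using cw(2) by (metis inner_scaleR_left)
    then show ?thesis
      by (simp add: z_def s_def inner_diff_left inner_diff_right ss inner_commute algebra_simps)
  qed
  have "norm (w + \<epsilon> *\<^sub>R z) < norm w" if e: "0 < \<epsilon>" "\<epsilon> < norm w" for \<epsilon>
  proof -
    have "(norm (w + \<epsilon> *\<^sub>R z))\<^sup>2 = (norm w)\<^sup>2 + 2 * \<epsilon> * (w \<bullet> z) + \<epsilon>\<^sup>2 * (z \<bullet> z)"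
      unfolding power2_norm_eq_inner
      by (simp add: inner_add_left inner_add_right inner_commute power2_eq_square algebra_simps)
    also have "\<dots> = (norm w)\<^sup>2 - 2 * (1 - s) * \<epsilon> * (norm w - \<epsilon>)"
      unfolding wz zz by (simp add: algebra_simps power2_eq_square)
    also have "\<dots> < (norm w)\<^sup>2" using e s1 by simp
    finally show ?thesis by (rule power_less_imp_less_base) simp
  qed
  then have "\<not> local_max (drifted \<rho> c) w"
    using drifted_not_local_max[of \<rho> z c "norm w" w, OF anti] zc s1 \<open>w \<noteq> 0\<close> by simp
  with lm show False by contradiction
qed

lemma drifted_ray:
  assumes "c \<noteq> 0" "t \<ge> 0"
  shows "drifted \<rho> c (t *\<^sub>R sgn c) = ennreal (exp (norm c * t)) * \<rho> t"
proof -
  have "sgn c \<bullet> c = norm c" using assms by (simp add: sgn_div_norm dot_square_norm power2_eq_square)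
  then show ?thesis using assms by (simp add: drifted_def norm_sgn mult.commute)
qed

lemma drifted_le_ray: "drifted \<rho> c w \<le> ennreal (exp (norm c * norm w)) * \<rho> (norm w)"
  unfolding drifted_def using norm_cauchy_schwarz[of w c]
  by (intro mult_right_mono ennreal_leI) (simp_all add: mult.commute)

context radial_mixture
begin

text \<open>Local maxima lie on the ray of \<open>c\<close> and are local maxima of
  \<open>ray\<close>, so only \<open>t0\<close> is possible. By Cauchy-Schwarz the ray carries the
  largest value for each norm, so the point at \<open>t0\<close> is a global maximum. The last
  conclusion serves to identify \<open>t0\<close>.\<close>

lemma drifted_unique_local_max:
  fixes c :: "'a::euclidean_space"
  assumes c: "c \<noteq> 0" "k = norm c"
    and qc: "\<And>u x v. 0 < u \<Longrightarrow> u \<le> x \<Longrightarrow> x \<le> v \<Longrightarrow> min (h u) (h v) \<le> h x"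
  obtains t0 where "t0 \<ge> 0" "\<And>w. local_max (drifted rp c) w \<longleftrightarrow> w = t0 *\<^sub>R sgn c"
    "\<And>t. t \<ge> 0 \<Longrightarrow> (\<And>s. s \<ge> 0 \<Longrightarrow> ray s \<le> ray t) \<Longrightarrow> t = t0"
proof -
  have "k > 0" using c by simp
  obtain t0 where t0: "t0 \<ge> 0" "\<And>t. t \<ge> 0 \<Longrightarrow> ray t \<le> ray t0"
    "\<And>t. t \<ge> 0 \<Longrightarrow> (\<forall>\<^sub>F s in at t within {0..}. ray s \<le> ray t) \<Longrightarrow> t = t0"
    by (rule ray_unique_local_max[OF \<open>k > 0\<close> qc]) blast+
  have on_ray: "drifted rp c (t *\<^sub>R sgn c) = ray t" if "t \<ge> 0" for t
    using drifted_ray[OF c(1) that, of rp, folded c(2)] by (simp only: ray_def)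
  have "w = t0 *\<^sub>R sgn c" if lm: "local_max (drifted rp c) w" for w
  proof -
    have w: "w = norm w *\<^sub>R sgn c"
      by (rule local_max_drifted_on_ray[OF radial_part_strict_antimono c(1) lm])
    have "((\<lambda>t. t *\<^sub>R sgn c) \<longlongrightarrow> norm w *\<^sub>R sgn c) (at (norm w) within {0..})" by (intro tendsto_intros)
    then have "((\<lambda>t. t *\<^sub>R sgn c) \<longlongrightarrow> w) (at (norm w) within {0..})" using w by simp
    from filterlim_iff[THEN iffD1, OF this] lm
    have 1: "\<forall>\<^sub>F s in at (norm w) within {0..}. drifted rp c (s *\<^sub>R sgn c) \<le> drifted rp c w"
      unfolding local_max_def by blast
    have 2: "\<forall>\<^sub>F s in at (norm w) within {0..}. s \<ge> 0" by (simp add: eventually_at_filter)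
    have 3: "drifted rp c w = ray (norm w)" by (subst w) (rule on_ray, simp)
    from 1 2 have "\<forall>\<^sub>F s in at (norm w) within {0..}. ray s \<le> ray (norm w)"
      by eventually_elim (simp add: 3 on_ray)
    then have "norm w = t0" by (intro t0(3)) auto
    then show ?thesis using w by simp
  qed
  moreover have "drifted rp c y \<le> ray t0" for y
    using order_trans[OF drifted_le_ray[of rp c y, folded c(2), folded ray_def] t0(2)] by simp
  then have "local_max (drifted rp c) (t0 *\<^sub>R sgn c)"
    unfolding local_max_def on_ray[OF t0(1)] by (intro always_eventually) simp
  ultimately have iff: "local_max (drifted rp c) w \<longleftrightarrow> w = t0 *\<^sub>R sgn c" for w by blast
  show ?thesis
  proof (rule that[OF t0(1) iff])
    show "t = t0" if "t \<ge> 0" "\<And>s. s \<ge> 0 \<Longrightarrow> ray s \<le> ray t" for t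
      using that by (intro t0(3)) (auto simp: eventually_at_filter)
  qed
qed

text \<open>The exponential is log-linear. A decreasing log-concave \<open>R\<close> composed with
  the convex norm is log-concave.\<close>

lemma drifted_log_concave:
  fixes c :: "'a::euclidean_space"
  assumes lc: "log_concave_on {0<..} h" and C: "C > 0"
  shows "drifted rp c w < \<infinity>" "log_concave_on UNIV (\<lambda>w. C * enn2real (drifted rp c w))"
proof -
  have int: "integrable lborel (\<lambda>x. radial_kernel k r x * h x)" if "r \<ge> 0" for r
    using log_concave_integrable_0[OF lc] integrable_radial[of r] that by (cases "r = 0") auto
  have dr: "drifted rp c w = ennreal (exp (w \<bullet> c) * R (norm w))" and Rp: "R (norm w) > 0" for w :: 'a
    using radial_part_eq[OF int] R_pos[OF int] by (simp_all add: drifted_def ennreal_mult less_imp_le)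
  show "drifted rp c w < \<infinity>" by (simp add: dr)
  have e: "enn2real (drifted rp c w) = exp (w \<bullet> c) * R (norm w)" for w
    unfolding dr using Rp[of w] by simp
  have "(C * (exp (x \<bullet> c) * R (norm x))) powr \<theta> * (C * (exp (y \<bullet> c) * R (norm y))) powr (1 - \<theta>)
      \<le> C * (exp ((\<theta> *\<^sub>R x + (1 - \<theta>) *\<^sub>R y) \<bullet> c) * R (norm (\<theta> *\<^sub>R x + (1 - \<theta>) *\<^sub>R y)))"
    if \<theta>: "0 < \<theta>" "\<theta> < 1" for x y \<theta>
  proof -
    define m where "m = \<theta> *\<^sub>R x + (1 - \<theta>) *\<^sub>R y"
    define r0 where "r0 = \<theta> * norm x + (1 - \<theta>) * norm y"
    have "norm m \<le> r0"
      unfolding m_def r0_def using norm_triangle_ineq[of "\<theta> *\<^sub>R x" "(1 - \<theta>) *\<^sub>R y"] \<theta> by simp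
    have "0 \<le> norm m" by simp
    have "R r0 \<le> R (norm m)"
    proof (cases "norm m = r0")
      case False
      then have "rp r0 < rp (norm m)" using \<open>norm m \<le> r0\<close> by (intro radial_part_strict_antimono) auto
      then show ?thesis
        using radial_part_eq[OF int[of r0]] radial_part_eq[OF int[of "norm m"]] \<open>norm m \<le> r0\<close> R_pos[OF int[of r0]]
          order_trans[OF \<open>0 \<le> norm m\<close> \<open>norm m \<le> r0\<close>] by (simp add: ennreal_less_iff)
    qed simp
    have "C powr \<theta> * C powr (1 - \<theta>) = C" using C by (simp flip: powr_add)
    moreover have "exp (x \<bullet> c) powr \<theta> * exp (y \<bullet> c) powr (1 - \<theta>) = exp (m \<bullet> c)"
      by (simp add: powr_def m_def inner_add_left mult.commute flip: exp_add)
    ultimately have "(C * (exp (x \<bullet> c) * R (norm x))) powr \<theta> * (C * (exp (y \<bullet> c) * R (norm y))) powr (1 - \<theta>)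
        = C * (exp (m \<bullet> c) * (R (norm x) powr \<theta> * R (norm y) powr (1 - \<theta>)))"
      using C Rp[of x] Rp[of y] by (simp add: powr_mult mult.assoc mult.left_commute)
    also have "\<dots> \<le> C * (exp (m \<bullet> c) * R r0)"
      unfolding r0_def using C R_log_concave[OF lc _ _ \<theta>, of "norm x" "norm y"] by simp
    also have "\<dots> \<le> C * (exp (m \<bullet> c) * R (norm m))" using C \<open>R r0 \<le> R (norm m)\<close> by simp
    finally show ?thesis unfolding m_def .
  qed
  then show "log_concave_on UNIV (\<lambda>w. C * enn2real (drifted rp c w))"
    unfolding log_concave_on_def e using C Rp by (auto simp: less_imp_le)
qed

text \<open>The norm is linear on the open ray spanned by \<open>v\<close>, so log-convexity of
  \<open>R\<close> at positive radii passes on directly.\<close>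

lemma drifted_log_convex:
  fixes c v :: "'a::euclidean_space"
  assumes lc: "log_convex_on {0<..} h" and C: "C > 0" and v: "v \<noteq> 0"
  shows "t > 0 \<Longrightarrow> drifted rp c (t *\<^sub>R v) < \<infinity>" "log_convex_on {0<..} (\<lambda>t. C * enn2real (drifted rp c (t *\<^sub>R v)))"
proof -
  have dr: "drifted rp c (t *\<^sub>R v) = ennreal (exp (t * (v \<bullet> c)) * R (t * norm v))" and Rp: "R (t * norm v) > 0"
    if "t > 0" for t
    using radial_part_eq_R[of "t * norm v"] R_pos'[of "t * norm v"] that v
    by (simp_all add: drifted_def ennreal_mult less_imp_le)
  show "t > 0 \<Longrightarrow> drifted rp c (t *\<^sub>R v) < \<infinity>" by (simp add: dr)
  have e: "C * enn2real (drifted rp c (t *\<^sub>R v)) = C * (exp (t * (v \<bullet> c)) * R (t * norm v))" if "t > 0" for t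
    unfolding dr[OF that] using Rp[OF that] by simp
  have l: "ln (C * enn2real (drifted rp c (t *\<^sub>R v))) = ln C + (t * (v \<bullet> c) + ln (R (t * norm v)))" if "t > 0" for t
    unfolding e[OF that] using Rp[OF that] C by (simp add: ln_mult)
  have "convex_on {0<..} (\<lambda>t. ln (C * enn2real (drifted rp c (t *\<^sub>R v))))"
  proof (rule convex_onI)
    fix \<theta> x y :: real assume \<theta>: "0 < \<theta>" "\<theta> < 1" and xy: "x \<in> {0<..}" "y \<in> {0<..}"
    define m where "m = (1 - \<theta>) *\<^sub>R x + \<theta> *\<^sub>R y"
    have m: "m > 0" using xy \<theta> by (simp add: m_def add_pos_pos)
    have "ln (R (m * norm v)) \<le> (1 - \<theta>) * ln (R (x * norm v)) + \<theta> * ln (R (y * norm v))"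
      using ln_R_convex[OF lc, of "x * norm v" "y * norm v" "1 - \<theta>"] xy v \<theta> by (simp add: m_def algebra_simps)
    then have "ln C + (m * (v \<bullet> c) + ln (R (m * norm v)))
        \<le> (1 - \<theta>) * (ln C + (x * (v \<bullet> c) + ln (R (x * norm v)))) + \<theta> * (ln C + (y * (v \<bullet> c) + ln (R (y * norm v))))"
      by (simp add: m_def algebra_simps)
    then show "ln (C * enn2real (drifted rp c (((1 - \<theta>) *\<^sub>R x + \<theta> *\<^sub>R y) *\<^sub>R v)))
        \<le> (1 - \<theta>) * ln (C * enn2real (drifted rp c (x *\<^sub>R v))) + \<theta> * ln (C * enn2real (drifted rp c (y *\<^sub>R v)))"
      using l[OF m] l[of x] l[of y] xy unfolding m_def by simp
  qed simp
  then show "log_convex_on {0<..} (\<lambda>t. C * enn2real (drifted rp c (t *\<^sub>R v)))"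
    unfolding log_convex_on_def using Rp C by (auto simp: e)
qed

end

section \<open>The normal variance-mean mixture\<close>

lemma local_max_comp:
  fixes L :: "'a::t2_space \<Rightarrow> 'b::t2_space"
  assumes "isCont L y" "local_max D (L y)"
  shows "local_max (\<lambda>y. D (L y)) y"
proof -
  have "filterlim L (nhds (L y)) (nhds y)"
    using assms(1) unfolding isCont_def tendsto_at_iff_tendsto_nhds .
  from filterlim_iff[THEN iffD1, OF this] assms(2) show ?thesis
    unfolding local_max_def by blast
qed

lemma local_max_homeomorphism:
  fixes L :: "'a::t2_space \<Rightarrow> 'b::t2_space" and K :: "'b \<Rightarrow> 'a"
  assumes L: "continuous_on UNIV L" and K: "continuous_on UNIV K"
    and inv: "\<And>y. K (L y) = y" "\<And>w. L (K w) = w"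
  shows "local_max (\<lambda>y. D (L y)) y \<longleftrightarrow> local_max D (L y)"
proof
  assume "local_max (\<lambda>y. D (L y)) y"
  then have "local_max (\<lambda>w. D (L (K w))) (L y)"
    using K by (intro local_max_comp[where L = K and D = "\<lambda>y. D (L y)"]) (auto simp: inv continuous_on_eq_continuous_at)
  then show "local_max D (L y)" by (simp add: inv)
next
  assume "local_max D (L y)"
  then show "local_max (\<lambda>y. D (L y)) y"
    using L by (intro local_max_comp[where L = L and D = D]) (auto simp: continuous_on_eq_continuous_at)
qed

lemma local_max_cmult_ennreal:
  assumes "C > 0"
  shows "local_max (\<lambda>y. ennreal C * D y) y \<longleftrightarrow> local_max D y"
  unfolding local_max_def using assms by (simp add: ennreal_mult_le_mult_iff)

text \<open>Expanding the square of \<open>norm (w - x *\<^sub>R c)\<close> and dividing by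
  \<open>2 * x\<close> leaves \<open>w \<bullet> c\<close> free of \<open>x\<close>; this factor
  leaves the integral, and the rest depends on \<open>w\<close> only through its norm.\<close>

lemma mixture_density_eq_drifted:
  fixes \<mu> \<beta> y :: "real ^ 'p" and A :: "real ^ 'p ^ 'p" and g :: "real \<Rightarrow> real"
  defines "c \<equiv> matrix_inv A *v \<beta>" and "w \<equiv> matrix_inv A *v (y - \<mu>)" and "h \<equiv> gstar CARD('p) g"
  assumes m: "(\<lambda>x. radial_kernel (norm c) (norm w) x * h x) \<in> borel_measurable borel"
  shows "mixture_density \<mu> \<beta> A g y =
    ennreal ((2 * pi) powr (- real CARD('p) / 2) * inverse \<bar>det A\<bar>) * drifted (radial_part (norm c) h) c w"
proof -
  define C where "C = (2 * pi) powr (- real CARD('p) / 2) * inverse \<bar>det A\<bar>"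
  have C: "C \<ge> 0" by (simp add: C_def)
  have lin: "matrix_inv A *v (y - \<mu> - x *\<^sub>R \<beta>) = w - x *\<^sub>R c" for x
    unfolding w_def c_def by (simp add: matrix_vector_mult_diff_distrib matrix_vector_mult_scaleR)
  have "ennreal ((2 * pi * x) powr (- real CARD('p) / 2) * inverse \<bar>det A\<bar>
         * exp (- (norm (matrix_inv A *v (y - \<mu> - x *\<^sub>R \<beta>)))\<^sup>2 / (2 * x)) * g x) * indicator {0<..} x
     = ennreal (C * exp (w \<bullet> c)) * ennreal (radial_kernel (norm c) (norm w) x * h x)" for x
  proof (cases "x > 0")
    case True
    have "(2 * pi * x) powr (- real CARD('p) / 2)
        = (2 * pi) powr (- real CARD('p) / 2) * (x powr (-1/2) * x powr (- (real CARD('p) - 1) / 2))"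
      using True by (simp add: powr_mult diff_divide_distrib flip: powr_add)
    moreover have "- (norm (w - x *\<^sub>R c))\<^sup>2 / (2 * x)
        = w \<bullet> c + (- ((norm w)\<^sup>2 / (2 * x)) - (norm c)\<^sup>2 * x / 2)"
      using True unfolding power2_norm_eq_inner
      by (simp add: inner_diff_left inner_diff_right inner_commute field_simps power2_eq_square)
    then have "exp (- (norm (w - x *\<^sub>R c))\<^sup>2 / (2 * x))
        = exp (w \<bullet> c) * exp (- ((norm w)\<^sup>2 / (2 * x)) - (norm c)\<^sup>2 * x / 2)"
      by (simp only: exp_add)
    ultimately have "(2 * pi * x) powr (- real CARD('p) / 2) * inverse \<bar>det A\<bar>
         * exp (- (norm (matrix_inv A *v (y - \<mu> - x *\<^sub>R \<beta>)))\<^sup>2 / (2 * x)) * g x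
      = (C * exp (w \<bullet> c)) * (radial_kernel (norm c) (norm w) x * h x)"
      using True unfolding lin by (simp add: C_def radial_kernel_def h_def gstar_def)
    then show ?thesis using True C by (simp add: ennreal_mult')
  qed (simp add: radial_kernel_def)
  then have "mixture_density \<mu> \<beta> A g y
      = (\<integral>\<^sup>+x. ennreal (C * exp (w \<bullet> c)) * ennreal (radial_kernel (norm c) (norm w) x * h x) \<partial>lborel)"
    unfolding mixture_density_def by simp
  also have "\<dots> = ennreal (C * exp (w \<bullet> c)) * radial_part (norm c) h (norm w)"
    unfolding radial_part_def using m by (intro nn_integral_cmult) simp
  also have "\<dots> = ennreal C * drifted (radial_part (norm c) h) c w"
    using C by (simp add: drifted_def ennreal_mult mult.assoc)
  finally show ?thesis unfolding C_def .
qed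

lemma radial_mixture_gstar:
  fixes g :: "real \<Rightarrow> real" and p :: nat
  assumes M: "prob_space M" and g_nonneg: "\<And>x. x > 0 \<Longrightarrow> g x \<ge> 0"
    and X: "distributed M lborel X (\<lambda>x. ennreal (indicator {0<..} x * g x))"
    and p: "p \<ge> 1" and k: "k \<ge> 0"
  shows "radial_mixture (gstar p g) ((real p - 1) / 2) k"
proof -
  interpret prob_space M by (rule M)
  have nn: "indicator {0<..} x * g x \<ge> 0" for x :: real using g_nonneg by (simp split: split_indicator)
  have m: "(\<lambda>x. indicator {0<..} x * g x) \<in> borel_measurable borel"
  proof -
    have "(\<lambda>x. enn2real (ennreal (indicator {0<..} x * g x))) \<in> borel_measurable lborel"
      using distributed_borel_measurable[OF X] by measurable
    then show ?thesis using nn by simp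
  qed
  have one: "(\<integral>\<^sup>+x. ennreal (indicator {0<..} x * g x) \<partial>lborel) = 1"
  proof -
    have "emeasure (distr M lborel X) UNIV = 1"
      using prob_space.emeasure_space_1[OF prob_space_distr[OF distributed_measurable[OF X]]] by simp
    then show ?thesis
      using distributed_borel_measurable[OF X]
      by (simp add: distributed_distr_eq_density[OF X] emeasure_density)
  qed
  have eq: "indicator {0<..} x * (x powr ((real p - 1) / 2) * gstar p g x) = indicator {0<..} x * g x" for x :: real
  proof -
    have "(real p - 1) / 2 + - (real p - 1) / 2 = 0" by (simp add: field_simps)
    then have "x powr ((real p - 1) / 2) * x powr (- (real p - 1) / 2) = 1" if "x > 0"
      using that by (simp only: powr_add[symmetric]) simp
    then show ?thesis by (auto simp: gstar_def mult.assoc[symmetric] split: split_indicator)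
  qed
  show ?thesis
  proof
    show "gstar p g x \<ge> 0" if "x > 0" for x using g_nonneg[OF that] by (simp add: gstar_def)
    have "(\<lambda>x. x powr (- (real p - 1) / 2) * (indicator {0<..} x * g x)) \<in> borel_measurable borel"
      by (intro borel_measurable_times m) measurable
    then show "(\<lambda>x. indicator {0<..} x * gstar p g x) \<in> borel_measurable borel"
      by (simp add: gstar_def mult.left_commute)
    show "integrable lborel (\<lambda>x. indicator {0<..} x * (x powr ((real p - 1) / 2) * gstar p g x))"
      unfolding eq integrable_iff_bounded using m nn one by simp
    show "\<not> (AE x in lborel. indicator {0<..} x * gstar p g x = 0)"
    proof
      assume "AE x in lborel. indicator {0<..} x * gstar p g x = 0"
      then have "AE x in lborel. ennreal (indicator {0<..} x * g x) = 0"
        by (rule eventually_mono) (auto simp: gstar_def split: split_indicator)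
      then have "(\<integral>\<^sup>+x. ennreal (indicator {0<..} x * g x) \<partial>lborel) = 0"
        using nn_integral_0_iff_AE[of "\<lambda>x. ennreal (indicator {0<..} x * g x)" lborel]
          distributed_borel_measurable[OF X] by simp
      then show False using one by simp
    qed
  qed (use p k in auto)
qed

lemma unimodal_pos_quasiconcave:
  assumes "unimodal_pos h" "0 < u" "u \<le> x" "x \<le> v"
  shows "min (h u) (h v) \<le> h x"
proof -
  obtain m where m: "m \<ge> 0" "mono_on {0<..m} h" "antimono_on ({m..} \<inter> {0<..}) h"
    using assms(1) unfolding unimodal_pos_def by blast
  show ?thesis
  proof (cases "x \<le> m")
    case True
    then have "h u \<le> h x" using assms by (intro monotone_onD[OF m(2)]) auto
    then show ?thesis by simp
  next
    case False
    then have "h v \<le> h x" using assms by (intro monotone_onD[OF m(3)]) auto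
    then show ?thesis by simp
  qed
qed

section \<open>Modality and log-shape of the mixture density\<close>

theorem theorem2:
  fixes M :: "'w measure"
    and X :: "'w \<Rightarrow> real"
    and Z Y :: "'w \<Rightarrow> real ^ 'p"
    and \<mu> \<beta> :: "real ^ 'p"
    and A :: "real ^ 'p ^ 'p"
    and g :: "real \<Rightarrow> real"
    and f :: "real ^ 'p \<Rightarrow> ennreal"
  assumes M: "prob_space M"
    and A: "rank A = CARD('p)"
    and g_nonneg: "\<And>x. x > 0 \<Longrightarrow> g x \<ge> 0"
    and X: "distributed M lborel X (\<lambda>x. ennreal (indicator {0<..} x * g x))"
    and Z: "distributed M lborel Z (\<lambda>z. ennreal (std_normal_vec_density z))"
    and XZ: "prob_space.indep_set M {X -` B \<inter> space M |B. B \<in> sets borel}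
                                 {Z -` C \<inter> space M |C. C \<in> sets borel}"
    and Y: "\<And>\<omega>. \<omega> \<in> space M \<Longrightarrow> Y \<omega> = \<mu> + X \<omega> *\<^sub>R \<beta> + sqrt (X \<omega>) *\<^sub>R (A *v Z \<omega>)"
    and f_density: "distributed M lborel Y f"
    and f: "f = mixture_density \<mu> \<beta> A g"
  shows
    "(unimodal_pos (gstar CARD('p) g) \<longrightarrow>
        (\<exists>!y. local_max f y) \<and> (\<forall>y. local_max f y \<longrightarrow> (\<exists>t. y = \<mu> + t *\<^sub>R \<beta>)))
   \<and> (antimono_on {0<..} (gstar CARD('p) g) \<or> \<beta> = 0 \<longrightarrow>
        (\<forall>y. local_max f y \<longleftrightarrow> y = \<mu>))
   \<and> (log_concave_on {0<..} (gstar CARD('p) g) \<longrightarrow>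
        (\<forall>y. f y < \<infinity>) \<and> log_concave_on UNIV (\<lambda>y. enn2real (f y)))
   \<and> (log_convex_on {0<..} (gstar CARD('p) g) \<longrightarrow>
        (\<forall>b. b \<noteq> 0 \<longrightarrow>
           (\<forall>t>0. f (\<mu> + t *\<^sub>R b) < \<infinity>) \<and>
           log_convex_on {0<..} (\<lambda>t. enn2real (f (\<mu> + t *\<^sub>R b)))))"
proof -
  define h where "h = gstar CARD('p) g"
  define c where "c = matrix_inv A *v \<beta>"
  define k where "k = norm c"
  \<comment> \<open>\<open>L\<close> standardizes the space variable and \<open>K\<close> inverts
    it; local maxima are transported along this homeomorphism.\<close>
  define L where "L y = matrix_inv A *v (y - \<mu>)" for y
  define K where "K w = \<mu> + A *v w" for w
  define C where "C = (2 * pi) powr (- real CARD('p) / 2) * inverse \<bar>det A\<bar>"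
  have "det A \<noteq> 0" using A by (simp add: det_eq_0_rank)
  then have invA: "invertible A" by (simp add: invertible_det_nz)
  then have AB: "A ** matrix_inv A = mat 1" "matrix_inv A ** A = mat 1"
    unfolding matrix_inv_def invertible_def by (metis (mono_tags, lifting) someI_ex)+
  have "C > 0" using \<open>det A \<noteq> 0\<close> by (simp add: C_def)
  have KL: "K (L y) = y" and LK: "L (K w) = w" for y w
    by (simp_all add: K_def L_def matrix_vector_mul_assoc AB)
  have Ac: "A *v c = \<beta>" by (simp add: c_def matrix_vector_mul_assoc AB)
  have c0: "c = 0 \<longleftrightarrow> \<beta> = 0" using Ac by (auto simp: c_def)
  have cont: "continuous_on UNIV L" "continuous_on UNIV K"
    unfolding L_def K_def
    by (auto intro!: continuous_intros bounded_linear.continuous_on[OF matrix_vector_mul_bounded_linear])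
  interpret radial_mixture h "(real CARD('p) - 1) / 2" k
    unfolding h_def by (rule radial_mixture_gstar[OF M g_nonneg X]) (auto simp: k_def)
  have fD: "f y = ennreal C * drifted rp c (L y)" for y
    unfolding f C_def k_def c_def L_def h_def
    by (rule mixture_density_eq_drifted) (use kernel_h_measurable in \<open>simp add: h_def\<close>)
  have lm: "local_max f y \<longleftrightarrow> local_max (drifted rp c) (L y)" for y
  proof -
    have "local_max f y \<longleftrightarrow> local_max (\<lambda>y. drifted rp c (L y)) y"
      unfolding fD[abs_def] by (rule local_max_cmult_ennreal[OF \<open>C > 0\<close>])
    also have "\<dots> \<longleftrightarrow> local_max (drifted rp c) (L y)"
      by (rule local_max_homeomorphism[OF cont KL LK])
    finally show ?thesis .
  qed
  have L0: "L y = 0 \<longleftrightarrow> y = \<mu>" for y using KL[of y] by (auto simp: K_def L_def)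
  have centre: "local_max f y \<longleftrightarrow> y = \<mu>" if "\<beta> = 0" for y
    using local_max_drifted_0[where w = "L y", OF radial_part_strict_antimono] that c0 by (simp add: lm L0)
  have i: "(\<exists>!y. local_max f y) \<and> (\<forall>y. local_max f y \<longrightarrow> (\<exists>t. y = \<mu> + t *\<^sub>R \<beta>))"
    if uni: "unimodal_pos h"
  proof (cases "\<beta> = 0")
    case True
    then show ?thesis using centre by auto
  next
    case False
    then have "c \<noteq> 0" using c0 by simp
    obtain t0 where "\<And>w. local_max (drifted rp c) w \<longleftrightarrow> w = t0 *\<^sub>R sgn c"
      by (rule drifted_unique_local_max[OF \<open>c \<noteq> 0\<close> k_def], erule (2) unimodal_pos_quasiconcave[OF uni], blast)
    then have "local_max f y \<longleftrightarrow> L y = t0 *\<^sub>R sgn c" for y by (simp add: lm)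
    moreover have "L y = t0 *\<^sub>R sgn c \<longleftrightarrow> y = K (t0 *\<^sub>R sgn c)" for y using KL LK by metis
    \<comment> \<open>The ray of \<open>c\<close> is mapped into the line of \<beta> because
      \<open>A\<close> sends \<open>c\<close> to \<beta>.\<close>
    moreover have "K (t0 *\<^sub>R sgn c) = \<mu> + (t0 / norm c) *\<^sub>R \<beta>"
      by (simp add: K_def sgn_div_norm matrix_vector_mult_scaleR Ac divide_inverse)
    ultimately have "local_max f y \<longleftrightarrow> y = \<mu> + (t0 / norm c) *\<^sub>R \<beta>" for y by simp
    then show ?thesis by auto
  qed
  have ii: "local_max f y \<longleftrightarrow> y = \<mu>" if anti: "antimono_on {0<..} h" and "\<beta> \<noteq> 0" for y
  proof -
    have "c \<noteq> 0" using c0 \<open>\<beta> \<noteq> 0\<close> by simp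
    have qc: "min (h u) (h v) \<le> h x" if "0 < u" "u \<le> x" "x \<le> v" for u x v
      using monotone_onD[OF anti, of x v] that by auto
    obtain t0 where t0: "\<And>w. local_max (drifted rp c) w \<longleftrightarrow> w = t0 *\<^sub>R sgn c"
      "\<And>t. t \<ge> 0 \<Longrightarrow> (\<And>s. s \<ge> 0 \<Longrightarrow> ray s \<le> ray t) \<Longrightarrow> t = t0"
      by (rule drifted_unique_local_max[OF \<open>c \<noteq> 0\<close> k_def], erule (2) qc, blast)
    \<comment> \<open>For decreasing \<open>h\<close> the ray function is maximal at 0, which
      identifies \<open>t0\<close> and hence \<mu>.\<close>
    have "0 = t0" using ray_le_ray_0[OF _ anti] \<open>c \<noteq> 0\<close> by (intro t0(2)) (auto simp: k_def)
    then show ?thesis using t0(1) by (simp add: lm L0)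
  qed
  have iii: "(\<forall>y. f y < \<infinity>) \<and> log_concave_on UNIV (\<lambda>y. enn2real (f y))" if lc: "log_concave_on {0<..} h"
  proof -
    note D = drifted_log_concave[OF lc \<open>C > 0\<close>, of c]
    have aff: "L (\<theta> *\<^sub>R x + (1 - \<theta>) *\<^sub>R y) = \<theta> *\<^sub>R L x + (1 - \<theta>) *\<^sub>R L y" for \<theta> x y
      unfolding L_def
      by (simp add: matrix_vector_mult_scaleR algebra_simps matrix_vector_mult_diff_distrib matrix_vector_right_distrib)
    have e: "enn2real (f y) = C * enn2real (drifted rp c (L y))" for y
      unfolding fD using \<open>C > 0\<close> by (simp add: enn2real_mult)
    have "f y < \<infinity>" for y unfolding fD using D(1)[of "L y"] by (simp add: ennreal_mult_less_top)
    then show ?thesis using D(2) unfolding log_concave_on_def e aff by auto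
  qed
  have iv: "(\<forall>t>0. f (\<mu> + t *\<^sub>R b) < \<infinity>) \<and> log_convex_on {0<..} (\<lambda>t. enn2real (f (\<mu> + t *\<^sub>R b)))"
    if lc: "log_convex_on {0<..} h" and "b \<noteq> 0" for b
  proof -
    define v where "v = matrix_inv A *v b"
    have "A *v v = b" by (simp add: v_def matrix_vector_mul_assoc AB)
    then have "v \<noteq> 0" using \<open>b \<noteq> 0\<close> by auto
    have Lt: "L (\<mu> + t *\<^sub>R b) = t *\<^sub>R v" for t by (simp add: L_def v_def matrix_vector_mult_scaleR)
    note D = drifted_log_convex[OF lc \<open>C > 0\<close> \<open>v \<noteq> 0\<close>, where c = c]
    have "f (\<mu> + t *\<^sub>R b) < \<infinity>" if "t > 0" for t
      unfolding fD Lt using D(1)[OF that] by (simp add: ennreal_mult_less_top)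
    moreover have "enn2real (f (\<mu> + t *\<^sub>R b)) = C * enn2real (drifted rp c (t *\<^sub>R v))" for t
      unfolding fD Lt using \<open>C > 0\<close> by (simp add: enn2real_mult)
    ultimately show ?thesis using D(2) by simp
  qed
  show ?thesis
    unfolding h_def[symmetric]
  proof (rule conjI[OF impI conjI[OF impI conjI[OF impI impI]]])
    show "\<forall>y. local_max f y \<longleftrightarrow> y = \<mu>" if "antimono_on {0<..} h \<or> \<beta> = 0"
      using that ii centre by (cases "\<beta> = 0") auto
  qed (rule i iii, assumption | (intro allI impI, rule iv))+
qed

end
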